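(* Let $d, k, r$ be positive integers with $k < d$ and $r \ge k+2$. Then, as $n \to \infty$, $f_{\mathrm{aff}}(n,d,k,r) = \Omega(f_{d,k,r}(n))$, where $$f_{d,k,r}(n) = \begin{cases} n^{d(1-k/(r-1))}, & \text{if } r \le d,\\ n^{d-k}/(\log n)^{1/d}, & \text{if } r = d+1,\\ n^{d-k}, & \text{otherwise.}\end{cases}$$ In particular, if $r = k+2$, then $f_{\mathrm{aff}}(n,d,k,k+2) = \Omega(f_{d,k}(n))$, where $$f_{d,k}(n) = \begin{cases} n/(\log n)^{1/d}, & \text{if } k = d-1,\\ n^{d/(k+1)}, & \text{otherwise.}\end{cases}$$
   Context: $[n] = \{1,\dots,n\}$. For positive integers $n,d,k,r$ with $k<d$ and $r\ge k+2$, $f_{\mathrm{aff}}(n,d,k,r)$ is the maximum size of a subset of $[n]^d \subset \mathbb{R}^d$ such that no $r$ (distinct) points of the subset lie on a common $k$-dimensional affine subspace of $\mathbb{R}^d$. Here $d,k,r$ are fixed and $n\to\infty$; implied constants may depend on $d,k,r$. *)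

theory Defs
  imports "HOL-Analysis.Analysis" "HOL-Library.Landau_Symbols"
begin

text \<open>The ambient space $\mathbb{R}^d$ is \<^typ>\<open>real ^ 'd\<close> with \<open>d = CARD('d)\<close>.\<close>

definition grid :: "nat \<Rightarrow> (real ^ 'd) set" where
  "grid n = {x. \<forall>i. x $ i \<in> real ` {1..n}}"

definition no_r_on_k_flat :: "nat \<Rightarrow> nat \<Rightarrow> (real ^ 'd) set \<Rightarrow> bool" where
  "no_r_on_k_flat k r A \<longleftrightarrow>
     \<not> (\<exists>F B. affine F \<and> aff_dim F = int k \<and> B \<subseteq> A \<inter> F \<and> finite B \<and> card B = r)"

text \<open>
  The set of which the maximum is taken is finite because \<open>grid n\<close> is, and for \<open>r > 0\<close> it is
  nonempty because it contains \<open>card {}\<close>.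
  The first argument only carries the dimension.
\<close>

definition f_aff :: "'d::finite itself \<Rightarrow> nat \<Rightarrow> nat \<Rightarrow> nat \<Rightarrow> nat" where
  "f_aff (_ :: 'd::finite itself) n k r =
     Max {card A | A :: (real ^ 'd) set. A \<subseteq> grid n \<and> no_r_on_k_flat k r A}"

definition f_dkr :: "nat \<Rightarrow> nat \<Rightarrow> nat \<Rightarrow> nat \<Rightarrow> real" where
  "f_dkr d k r n =
     (if r \<le> d then real n powr (real d * (1 - real k / (real r - 1)))
      else if r = d + 1 then real n powr (real d - real k) / ln (real n) powr (1 / real d)
      else real n powr (real d - real k))"

definition f_dk :: "nat \<Rightarrow> nat \<Rightarrow> nat \<Rightarrow> real" where
  "f_dk d k n =
     (if k + 1 = d then real n / ln (real n) powr (1 / real d)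
      else real n powr (real d / (real k + 1)))"

end

theory Submission
  imports Defs
begin

text \<open>
  Random deletion. If \<open>r\<close> points lie on a common \<open>k\<close>-flat, their differences to one of them
  form \<open>m = r - 1\<close> integer vectors of norm \<open>O(n)\<close> and rank at most \<open>k\<close>, so everything
  depends on bounding the number of such tuples. The integer vectors in the span of a tuple of rank
  \<open>k\<close> form a lattice, and every vector of the tuple has coefficients of size \<open>O(n / norm (b j))\<close>
  in a reduced basis \<open>b\<close> of it. Hence the number of tuples is at most the sum of the products
  of \<open>O((n / norm (b j)) ^ m)\<close> over all reduced \<open>b\<close>. Summing over all
  \<open>b j\<close> independently gives the correct order unless \<open>m = d\<close>, where it gives
  \<open>log n\<close> to the power \<open>k\<close>. In that case one uses that \<open>b 0\<close> is shortest and
  \<open>b j\<close> is size-reduced with respect to \<open>b 0\<close>: the sum over \<open>b j\<close> for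
  \<open>j > 0\<close> then loses its logarithm, and only the one from \<open>b 0\<close> remains.
\<close>

section \<open>Reduced bases\<close>


text \<open>These are the lattices of the subspaces they span. Discreteness is expressed by
  finiteness in every ball, so the notion refers neither to a basis nor to a rank.\<close>

definition discrete_subgroup :: "'a::euclidean_space set \<Rightarrow> bool" where
  "discrete_subgroup L \<longleftrightarrow>
     0 \<in> L \<and> (\<forall>x\<in>L. \<forall>y\<in>L. x - y \<in> L) \<and> (\<forall>R. finite {x\<in>L. norm x \<le> R})"

text \<open>A weak form of lattice reduction. The last clause is quantitative: the coefficient of
  \<open>b j\<close> in \<open>x\<close> is at most \<open>C * norm x / norm (b j)\<close> in
  absolute value. If \<open>dim L = k\<close>, independence is implicit, because the
  \<open>k\<close> vectors span the same space as \<open>L\<close>.\<close>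

definition reduced_basis :: "real \<Rightarrow> 'a::euclidean_space set \<Rightarrow> nat \<Rightarrow> (nat \<Rightarrow> 'a) \<Rightarrow> bool" where
  "reduced_basis C L k b \<longleftrightarrow>
     (\<forall>j<k. b j \<in> L \<and> b j \<noteq> 0 \<and> norm (b 0) \<le> norm (b j)) \<and>
     (\<forall>j. 0 < j \<and> j < k \<longrightarrow> 2 * \<bar>b j \<bullet> b 0\<bar> \<le> (norm (b 0))\<^sup>2) \<and>
     (\<forall>x\<in>L. \<exists>c :: nat \<Rightarrow> int. x = (\<Sum>j<k. of_int (c j) *\<^sub>R b j) \<and>
        (\<forall>j<k. \<bar>of_int (c j)\<bar> * norm (b j) \<le> C * norm x))"

lemma discrete_subgroup_add:
  assumes "discrete_subgroup L" "x \<in> L" "y \<in> L"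
  shows "x + y \<in> L"
proof -
  have "0 - y \<in> L" using assms by (auto simp: discrete_subgroup_def)
  then have "x - (0 - y) \<in> L" using assms unfolding discrete_subgroup_def by blast
  then show ?thesis by simp
qed

lemma discrete_subgroup_scale_int:
  assumes "discrete_subgroup L" "x \<in> L"
  shows "of_int c *\<^sub>R x \<in> L"
proof (induction c rule: int_induct[where k = 0])
  case base
  then show ?case using assms by (simp add: discrete_subgroup_def)
next
  case (step1 i)
  then show ?case using discrete_subgroup_add[OF assms(1) step1(2) assms(2)]
    by (simp add: scaleR_add_left)
next
  case (step2 i)
  then have "of_int i *\<^sub>R x - x \<in> L" using assms by (auto simp: discrete_subgroup_def)
  then show ?case by (simp add: scaleR_left_diff_distrib)
qed

lemma discrete_subgroup_sum:
  assumes "discrete_subgroup L" "\<And>j. j \<in> J \<Longrightarrow> f j \<in> L"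
  shows "sum f J \<in> L"
  using assms(2)
proof (induction J rule: infinite_finite_induct)
  case (insert x F)
  then show ?case using discrete_subgroup_add[OF assms(1)] by simp
qed (use assms(1) in \<open>auto simp: discrete_subgroup_def\<close>)

lemma discrete_subgroup_shortest:
  assumes "discrete_subgroup L" "x \<in> L" "x \<noteq> 0"
  obtains u where "u \<in> L" "u \<noteq> 0" "\<And>y. y \<in> L \<Longrightarrow> y \<noteq> 0 \<Longrightarrow> norm u \<le> norm y"
proof -
  let ?S = "{y\<in>L. norm y \<le> norm x} - {0}"
  have fin: "finite ?S" using assms by (auto simp: discrete_subgroup_def)
  have ne: "x \<in> ?S" using assms by auto
  define u where "u = arg_min_on norm ?S"
  have u: "u \<in> ?S"
    unfolding u_def by (rule arg_min_if_finite(1)[OF fin]) (use ne in blast)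
  have least: "norm u \<le> norm y" if "y \<in> ?S" for y
    unfolding u_def by (rule arg_min_least[OF fin _ that]) (use ne in blast)
  have "norm u \<le> norm y" if "y \<in> L" "y \<noteq> 0" for y
    using u least[of y] that by (cases "norm y \<le> norm x") auto
  with u show ?thesis by (intro that[of u]) auto
qed

text \<open>Induction on the rank: split off a shortest vector \<open>u\<close>, project
  orthogonally to \<open>u\<close>, and lift a reduced basis of the projection with components along
  \<open>u\<close> as small as possible. The constant precedes the quantifier over \<open>L\<close>,
  so it depends on the rank and the space but not on the lattice.\<close>

lemma ex_reduced_basis:
  "\<exists>C\<ge>1. \<forall>L :: 'a::euclidean_space set. discrete_subgroup L \<and> dim L = k \<longrightarrow>
     (\<exists>b. reduced_basis C L k b)"
proof (induction k)
  case 0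
  have "reduced_basis 1 L 0 b" if "discrete_subgroup L" "dim L = 0" for L :: "'a set" and b
    using that by (auto simp: reduced_basis_def dim_eq_0)
  then show ?case by (intro exI[of _ 1]) auto
next
  case (Suc k)
  then obtain C where C: "C \<ge> 1"
    and IH: "\<And>L :: 'a set. discrete_subgroup L \<Longrightarrow> dim L = k \<Longrightarrow> \<exists>b. reduced_basis C L k b"
    by blast
  \<comment> \<open>Large enough for the two bounds below: \<open>1 + 2 * k * C\<close> for the
    coefficient of \<open>u\<close> and \<open>2 * C\<close> for the lifted vectors.\<close>
  define C' where "C' = 1 + 2 * (real k + 1) * C"
  have "\<exists>b. reduced_basis C' L (Suc k) b" if L: "discrete_subgroup L" and dimL: "dim L = Suc k"
    for L :: "'a set"
  proof -
    obtain x where "x \<in> L" "x \<noteq> 0"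
      using dimL by (metis dim_eq_0 insertCI nat.distinct(1) subsetI)
    then obtain u where u: "u \<in> L" "u \<noteq> 0" "\<And>y. y \<in> L \<Longrightarrow> y \<noteq> 0 \<Longrightarrow> norm u \<le> norm y"
      using discrete_subgroup_shortest[OF L] by blast
    define P where "P y = y - ((y \<bullet> u) / (u \<bullet> u)) *\<^sub>R u" for y
    have nu: "norm u > 0" and uu: "u \<bullet> u > 0" using u by auto
    have linP: "linear P"
      unfolding P_def by (intro linearI) (auto simp: algebra_simps inner_simps add_divide_distrib)
    have orth: "P y \<bullet> u = 0" for y using uu by (simp add: P_def inner_simps)
    have pyth: "(norm y)\<^sup>2 = (norm (P y))\<^sup>2 + (y \<bullet> u)\<^sup>2 / (norm u)\<^sup>2" for y
    proof -
      have "y = P y + ((y \<bullet> u) / (u \<bullet> u)) *\<^sub>R u" by (simp add: P_def)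
      moreover have "orthogonal (P y) (((y \<bullet> u) / (u \<bullet> u)) *\<^sub>R u)"
        using orth by (simp add: orthogonal_def)
      ultimately have "(norm y)\<^sup>2 = (norm (P y))\<^sup>2 + (norm (((y \<bullet> u) / (u \<bullet> u)) *\<^sub>R u))\<^sup>2"
        by (metis norm_add_Pythagorean)
      also have "(norm (((y \<bullet> u) / (u \<bullet> u)) *\<^sub>R u))\<^sup>2 = (y \<bullet> u)\<^sup>2 / (norm u)\<^sup>2"
        using nu by (simp add: power_mult_distrib power_divide dot_square_norm field_simps power2_eq_square)
      finally show ?thesis .
    qed
    have Ple: "norm (P y) \<le> norm y" for y
    proof (rule power2_le_imp_le)
      show "(norm (P y))\<^sup>2 \<le> (norm y)\<^sup>2" unfolding pyth[of y] by simp
    qed simp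
    \<comment> \<open>Subtracting the nearest integer multiple of \<open>u\<close> keeps the
      projection and leaves a component along \<open>u\<close> of length at most
      \<open>norm u / 2\<close>.\<close>
    have lift: "\<exists>z\<in>L. P z = P y \<and> 2 * \<bar>z \<bullet> u\<bar> \<le> (norm u)\<^sup>2" if "y \<in> L" for y
    proof -
      define t where "t = (y \<bullet> u) / (u \<bullet> u)"
      define z where "z = y - of_int (round t) *\<^sub>R u"
      have "z \<in> L" using that discrete_subgroup_scale_int[OF L u(1), of "round t"] L
        by (auto simp: z_def discrete_subgroup_def)
      moreover have "P z = P y"
        using uu by (simp add: z_def P_def inner_simps diff_divide_distrib scaleR_left_diff_distrib)
      moreover have "z \<bullet> u = (t - of_int (round t)) * (norm u)\<^sup>2"
        using uu by (simp add: z_def t_def inner_simps power2_norm_eq_inner left_diff_distrib)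
      then have "\<bar>z \<bullet> u\<bar> = \<bar>of_int (round t) - t\<bar> * (norm u)\<^sup>2"
        by (simp add: abs_mult abs_minus_commute)
      then have "2 * \<bar>z \<bullet> u\<bar> \<le> (norm u)\<^sup>2"
        using of_int_round_abs_le[of t] mult_right_mono[of "\<bar>of_int (round t) - t\<bar>" "1/2" "(norm u)\<^sup>2"]
        by simp
      ultimately show ?thesis by blast
    qed
    have short: "(norm z)\<^sup>2 \<le> (norm (P z))\<^sup>2 + (norm u)\<^sup>2 / 4" if "2 * \<bar>z \<bullet> u\<bar> \<le> (norm u)\<^sup>2" for z
    proof -
      have "(2 * \<bar>z \<bullet> u\<bar>)\<^sup>2 \<le> ((norm u)\<^sup>2)\<^sup>2" using that by (intro power_mono) auto
      then have "(z \<bullet> u)\<^sup>2 / (norm u)\<^sup>2 \<le> (norm u)\<^sup>2 / 4"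
        using nu by (simp add: power_mult_distrib divide_simps power2_eq_square)
      then show ?thesis using pyth[of z] by simp
    qed
    \<comment> \<open>Minimality of \<open>u\<close> turns \<open>short\<close> into
      \<open>(norm z)^2 \<le> (norm (P z))^2 + (norm z)^2 / 4\<close>, so lifting lengthens a vector
      by a bounded factor only.\<close>
    have short2: "norm z \<le> 2 * norm (P z)"
      if z: "z \<in> L" "P z \<noteq> 0" "2 * \<bar>z \<bullet> u\<bar> \<le> (norm u)\<^sup>2" for z
    proof -
      have "z \<noteq> 0" using z(2) linP by (auto simp: linear_0)
      then have "(norm u)\<^sup>2 \<le> (norm z)\<^sup>2" using u(3)[OF z(1)] by (intro power_mono) auto
      then have "(norm z)\<^sup>2 \<le> (2 * norm (P z))\<^sup>2"
      proof -
        have "(2 * norm (P z))\<^sup>2 = 4 * (norm (P z))\<^sup>2" by (simp add: power_mult_distrib)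
        then show ?thesis
          using short[OF z(3)] \<open>(norm u)\<^sup>2 \<le> (norm z)\<^sup>2\<close> zero_le_power2[of "norm (P z)"]
          by linarith
      qed
      then show ?thesis by (rule power2_le_imp_le) simp
    qed
    \<comment> \<open>Discreteness survives the projection because a bounded projected vector has a
      bounded lift, and \<open>L\<close> has finitely many of those.\<close>
    have PL: "discrete_subgroup (P ` L)"
      unfolding discrete_subgroup_def
    proof (intro conjI ballI allI)
      show "0 \<in> P ` L" using L linP by (metis discrete_subgroup_def image_eqI linear_0)
      fix x y assume "x \<in> P ` L" "y \<in> P ` L"
      then obtain a c where ac: "a \<in> L" "c \<in> L" "x = P a" "y = P c" by blast
      then have "a - c \<in> L" using L by (simp add: discrete_subgroup_def)
      moreover have "x - y = P (a - c)" using ac by (simp add: linear_diff[OF linP])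
      ultimately show "x - y \<in> P ` L" by blast
    next
      fix R
      have "{x \<in> P ` L. norm x \<le> R} \<subseteq> P ` {z \<in> L. norm z \<le> R + norm u}"
      proof safe
        fix y assume y: "y \<in> L" "norm (P y) \<le> R"
        obtain z where z: "z \<in> L" "P z = P y" "2 * \<bar>z \<bullet> u\<bar> \<le> (norm u)\<^sup>2" using lift[OF y(1)] by blast
        have "(norm z)\<^sup>2 \<le> (norm (P z) + norm u)\<^sup>2"
        proof -
          have "0 \<le> 2 * norm (P z) * norm u" "0 \<le> (norm u)\<^sup>2" by simp_all
          then show ?thesis using short[OF z(3)] unfolding power2_sum by linarith
        qed
        then have "norm z \<le> norm (P z) + norm u" by (rule power2_le_imp_le) simp
        then show "P y \<in> P ` {z \<in> L. norm z \<le> R + norm u}"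
          using z y by (intro image_eqI[of _ _ z]) auto
      qed
      then show "finite {x \<in> P ` L. norm x \<le> R}"
        using L finite_subset[OF _ finite_imageI, of _ P "{z \<in> L. norm z \<le> R + norm u}"]
        by (simp add: discrete_subgroup_def)
    qed
    have "dim (P ` L) = k"
    proof -
      have "P ` L \<subseteq> {y. u \<bullet> y = 0}" using orth by (auto simp: inner_commute)
      then have "span (P ` L) \<subseteq> {y. u \<bullet> y = 0}"
        by (intro span_minimal subspace_hyperplane)
      then have notin: "u \<notin> span (P ` L)" using uu by auto
      have "span L = span (insert u (P ` L))"
      proof (intro antisym span_minimal subspace_span subsetI)
        fix y assume "y \<in> L"
        have "P y + ((y \<bullet> u) / (u \<bullet> u)) *\<^sub>R u \<in> span (insert u (P ` L))"
          using \<open>y \<in> L\<close> by (intro span_add span_scale) (auto intro: span_base)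
        then show "y \<in> span (insert u (P ` L))" by (simp add: P_def)
      next
        fix y assume "y \<in> insert u (P ` L)"
        then show "y \<in> span L"
          using u(1) span_diff[OF span_base span_scale[OF span_base], of _ L u]
          by (auto simp: P_def span_base)
      qed
      then have "dim L = dim (insert u (P ` L))" by (metis dim_span)
      also have "\<dots> = Suc (dim (P ` L))" using notin by (simp add: dim_insert)
      finally show ?thesis using dimL by simp
    qed
    then obtain b' where b': "reduced_basis C (P ` L) k b'" using IH[OF PL] by blast
    have "\<exists>z. z \<in> L \<and> P z = b' j \<and> 2 * \<bar>z \<bullet> u\<bar> \<le> (norm u)\<^sup>2" if "j < k" for j
    proof -
      have "b' j \<in> P ` L" using b' that by (simp add: reduced_basis_def)
      then obtain y where "y \<in> L" "b' j = P y" by blast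
      then show ?thesis using lift[of y] by auto
    qed
    then obtain z where z: "\<And>j. j < k \<Longrightarrow> z j \<in> L" "\<And>j. j < k \<Longrightarrow> P (z j) = b' j"
      "\<And>j. j < k \<Longrightarrow> 2 * \<bar>z j \<bullet> u\<bar> \<le> (norm u)\<^sup>2" by metis
    have b'nz: "b' j \<noteq> 0" if "j < k" for j using b' that by (simp add: reduced_basis_def)
    have znz: "z j \<noteq> 0" if "j < k" for j
      using b'nz[OF that] z(2)[OF that] linP by (auto simp: linear_0)
    have zb: "norm (z j) \<le> 2 * norm (b' j)" if "j < k" for j
      using short2[of "z j"] z that b'nz by metis
    \<comment> \<open>The shortest vector gets index 0 and the lifts are shifted by one.\<close>
    define b where "b = case_nat u z"
    have "reduced_basis C' L (Suc k) b"
      unfolding reduced_basis_def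
    proof (intro conjI allI impI ballI)
      fix j assume "j < Suc k"
      then show "b j \<in> L" "b j \<noteq> 0" "norm (b 0) \<le> norm (b j)"
        using u z(1) znz by (auto simp: b_def split: nat.splits)
    next
      fix j assume "0 < j \<and> j < Suc k"
      then show "2 * \<bar>b j \<bullet> b 0\<bar> \<le> (norm (b 0))\<^sup>2"
        using z(3) by (auto simp: b_def split: nat.splits)
    next
      fix x assume x: "x \<in> L"
      then obtain c :: "nat \<Rightarrow> int" where c: "P x = (\<Sum>j<k. of_int (c j) *\<^sub>R b' j)"
        "\<And>j. j < k \<Longrightarrow> \<bar>of_int (c j)\<bar> * norm (b' j) \<le> C * norm (P x)"
        using b' unfolding reduced_basis_def by (meson imageI)
      \<comment> \<open>Using the coefficients of \<open>P x\<close> on the lifts leaves a remainder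
        in \<open>L\<close> that lies on the line through \<open>u\<close>.\<close>
      define w where "w = x - (\<Sum>j<k. of_int (c j) *\<^sub>R z j)"
      have wL: "w \<in> L"
      proof -
        have "(\<Sum>j<k. of_int (c j) *\<^sub>R z j) \<in> L"
          using z(1) by (intro discrete_subgroup_sum[OF L] discrete_subgroup_scale_int[OF L]) auto
        then show ?thesis using L x by (auto simp: w_def discrete_subgroup_def)
      qed
      have "P w = 0"
        using c(1) z(2) by (simp add: w_def linear_diff[OF linP] linear_sum[OF linP] linear_scale[OF linP])
      then have w: "w = ((w \<bullet> u) / (u \<bullet> u)) *\<^sub>R u" by (simp add: P_def)
      \<comment> \<open>Rounding the multiple of \<open>u\<close> would leave a lattice vector
        shorter than \<open>u\<close>; by minimality it is 0, so \<open>w\<close> is an integer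
        multiple of \<open>u\<close>.\<close>
      define t where "t = (w \<bullet> u) / (u \<bullet> u)"
      have "w - of_int (round t) *\<^sub>R u \<in> L"
        using wL discrete_subgroup_scale_int[OF L u(1), of "round t"] L
        by (auto simp: discrete_subgroup_def)
      moreover have eq: "w - of_int (round t) *\<^sub>R u = (t - of_int (round t)) *\<^sub>R u"
        by (subst w) (simp add: t_def scaleR_left_diff_distrib)
      moreover have "norm ((t - of_int (round t)) *\<^sub>R u) < norm u"
        using of_int_round_abs_le[of t] nu by (simp add: abs_minus_commute)
      ultimately have "w - of_int (round t) *\<^sub>R u = 0" using u(3) by fastforce
      then have wt: "w = of_int (round t) *\<^sub>R u" by simp
      define c' where "c' = case_nat (round t) c"
      have xe: "x = (\<Sum>j<Suc k. of_int (c' j) *\<^sub>R b j)"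
        using wt by (simp add: w_def c'_def b_def sum.lessThan_Suc_shift diff_eq_eq del: sum.lessThan_Suc)
      have cz: "\<bar>of_int (c j)\<bar> * norm (z j) \<le> 2 * C * norm x" if "j < k" for j
      proof -
        have "\<bar>of_int (c j)\<bar> * norm (z j) \<le> \<bar>of_int (c j)\<bar> * (2 * norm (b' j))"
          using zb[OF that] by (intro mult_left_mono) auto
        also have "\<dots> \<le> 2 * (C * norm (P x))" using c(2)[OF that] by simp
        also have "\<dots> \<le> 2 * (C * norm x)" using Ple[of x] C by (intro mult_left_mono) auto
        finally show ?thesis by simp
      qed
      \<comment> \<open>The coefficient of \<open>u\<close> is controlled last, by the triangle
        inequality from the bounds on all the others.\<close>
      have "\<bar>of_int (round t)\<bar> * norm u = norm w" by (simp add: wt)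
      also have "\<dots> \<le> norm x + norm (\<Sum>j<k. of_int (c j) *\<^sub>R z j)"
        unfolding w_def by (rule norm_triangle_ineq4)
      also have "norm (\<Sum>j<k. of_int (c j) *\<^sub>R z j) \<le> (\<Sum>j<k. 2 * C * norm x)"
        using cz by (intro sum_norm_le) auto
      finally have c0: "\<bar>of_int (round t)\<bar> * norm u \<le> (1 + 2 * real k * C) * norm x"
        by (simp add: algebra_simps)
      have le1: "(1 + 2 * real k * C) * norm x \<le> C' * norm x"
        using C by (intro mult_right_mono) (auto simp: C'_def algebra_simps)
      have "2 * C \<le> C'" using C by (simp add: C'_def algebra_simps)
      then have le2: "2 * C * norm x \<le> C' * norm x"
        by (intro mult_right_mono) auto
      have "\<bar>of_int (c' j)\<bar> * norm (b j) \<le> C' * norm x" if "j < Suc k" for j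
        using that c0 cz le1 le2 by (cases j) (auto simp: c'_def b_def intro: order_trans)
      with xe show "\<exists>c :: nat \<Rightarrow> int. x = (\<Sum>j<Suc k. of_int (c j) *\<^sub>R b j) \<and>
          (\<forall>j<Suc k. \<bar>of_int (c j)\<bar> * norm (b j) \<le> C' * norm x)" by blast
    qed
    then show ?thesis by blast
  qed
  moreover have "C' \<ge> 1" using C by (simp add: C'_def)
  ultimately show ?case by blast
qed

section \<open>Sums over integer vectors\<close>


definition int_vecs :: "(real ^ 'd) set" where
  "int_vecs = {x. \<forall>i. x $ i \<in> \<int>}"

section \<open>Counting integer vectors in boxes, balls and slabs\<close>

lemma bij_betw_vec_box: "bij_betw vec_nth {x :: 'a ^ 'd. \<forall>i. x $ i \<in> A i} (PiE UNIV A)"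
proof (rule bij_betw_byWitness[where f' = vec_lambda])
  show "\<forall>x\<in>{x. \<forall>i. x $ i \<in> A i}. vec_lambda (vec_nth x) = x" by (simp add: vec_lambda_eta)
  show "\<forall>f\<in>PiE UNIV A. vec_nth (vec_lambda f) = f" by auto
qed (auto simp: PiE_def Pi_def)

lemma card_vec_box: "card {x :: 'a ^ 'd. \<forall>i. x $ i \<in> A i} = (\<Prod>i\<in>UNIV. card (A i))"
  using bij_betw_same_card[OF bij_betw_vec_box[of A]] by (simp add: card_PiE)

lemma finite_vec_box:
  assumes "\<And>i. finite (A i)"
  shows "finite {x :: 'a ^ 'd. \<forall>i. x $ i \<in> A i}"
  using bij_betw_finite[OF bij_betw_vec_box[of A]] assms by (simp add: finite_PiE)

lemma Ints_interval: "{y :: real. y \<in> \<int> \<and> a \<le> y \<and> y \<le> b} = of_int ` {\<lceil>a\<rceil>..\<lfloor>b\<rfloor>}"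
  by (auto simp: Ints_def ceiling_le_iff le_floor_iff)

lemma finite_Ints_interval: "finite {y :: real. y \<in> \<int> \<and> a \<le> y \<and> y \<le> b}"
  by (simp add: Ints_interval)

lemma card_Ints_interval_le:
  fixes a b :: real
  assumes "0 \<le> b - a + 1"
  shows "real (card {y. y \<in> \<int> \<and> a \<le> y \<and> y \<le> b}) \<le> b - a + 1"
proof -
  have "card {y. y \<in> \<int> \<and> a \<le> y \<and> y \<le> b} = nat (\<lfloor>b\<rfloor> + 1 - \<lceil>a\<rceil>)"
    unfolding Ints_interval by (subst card_image) (auto simp: inj_on_def)
  moreover have "real_of_int \<lfloor>b\<rfloor> \<le> b" "a \<le> real_of_int \<lceil>a\<rceil>" by auto
  ultimately show ?thesis
    using assms by (cases "\<lfloor>b\<rfloor> + 1 - \<lceil>a\<rceil> \<ge> 0") (simp_all, linarith)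
qed

lemma int_vecs_ball_subset:
  "{x \<in> int_vecs. norm x \<le> R} \<subseteq> {x :: real ^ 'd. \<forall>i. x $ i \<in> {y. y \<in> \<int> \<and> -R \<le> y \<and> y \<le> R}}"
proof safe
  fix x :: "real ^ 'd" and i assume "x \<in> int_vecs" "norm x \<le> R"
  then show "x $ i \<in> \<int>" "-R \<le> x $ i" "x $ i \<le> R"
    using component_le_norm_cart[of x i] by (auto simp: int_vecs_def abs_le_iff)
qed

lemma finite_int_vecs_ball: "finite {x :: real ^ 'd \<in> int_vecs. norm x \<le> R}"
  by (rule finite_subset[OF int_vecs_ball_subset]) (intro finite_vec_box finite_Ints_interval)

lemma card_int_vecs_ball:
  assumes "0 \<le> R"
  shows "real (card {x :: real ^ 'd \<in> int_vecs. norm x \<le> R}) \<le> (2 * R + 1) ^ CARD('d)"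
proof -
  have "real (card {x :: real ^ 'd \<in> int_vecs. norm x \<le> R})
      \<le> real (card {x :: real ^ 'd. \<forall>i. x $ i \<in> {y. y \<in> \<int> \<and> -R \<le> y \<and> y \<le> R}})"
    by (intro of_nat_mono card_mono int_vecs_ball_subset finite_vec_box finite_Ints_interval)
  also have "\<dots> = (\<Prod>i\<in>(UNIV :: 'd set). real (card {y. y \<in> \<int> \<and> -R \<le> y \<and> y \<le> R}))"
    by (subst card_vec_box) simp
  also have "\<dots> \<le> (\<Prod>i\<in>(UNIV :: 'd set). 2 * R + 1)"
    using card_Ints_interval_le[where a = "-R" and b = R] assms by (intro prod_mono) auto
  finally show ?thesis by simp
qed

lemma norm_ge_1_int_vecs:
  assumes "x \<in> int_vecs" "x \<noteq> 0"
  shows "1 \<le> norm x"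
proof -
  obtain i where i: "x $ i \<noteq> 0" using assms(2) by (auto simp: vec_eq_iff)
  then have "1 \<le> \<bar>x $ i\<bar>" using assms(1) by (intro Ints_nonzero_abs_ge1) (auto simp: int_vecs_def)
  then show ?thesis using component_le_norm_cart[of x i] by linarith
qed

text \<open>Forget the coordinate in which \<open>u\<close> is large. The other \<open>d - 1\<close>
  coordinates range over a box, and the inner product condition confines the forgotten one to an
  interval of length \<open>O(norm u)\<close>. Compared with the whole ball this saves a factor of
  order \<open>norm u / R\<close>.\<close>

lemma card_int_vecs_slab:
  fixes u :: "real ^ 'd" and R :: real
  assumes u: "u \<in> int_vecs" "u \<noteq> 0" and R: "1 \<le> R"
  shows "real (card {x \<in> int_vecs. norm x \<le> R \<and> 2 * \<bar>x \<bullet> u\<bar> \<le> (norm u)\<^sup>2})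
           \<le> (3 * R) ^ (CARD('d) - 1) * (2 * real CARD('d) * norm u)"
proof -
  let ?X = "{x \<in> int_vecs. norm x \<le> R \<and> 2 * \<bar>x \<bullet> u\<bar> \<le> (norm u)\<^sup>2}"
  let ?d = "real CARD('d)"
  have nu: "1 \<le> norm u" using u by (rule norm_ge_1_int_vecs)
  have d1: "1 \<le> ?d" by (simp add: Suc_leI)
  \<comment> \<open>Averaging: the norm is at most the sum of the \<open>d\<close> absolute
    coordinates.\<close>
  have "\<exists>i. norm u \<le> ?d * \<bar>u $ i\<bar>"
  proof (rule ccontr)
    assume "\<not> ?thesis"
    then have *: "?d * \<bar>u $ i\<bar> < norm u" for i by (auto simp: not_le)
    have "?d * norm u \<le> ?d * (\<Sum>i\<in>UNIV. \<bar>u $ i\<bar>)"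
      by (intro mult_left_mono norm_le_l1_cart) auto
    also have "\<dots> = (\<Sum>i\<in>UNIV. ?d * \<bar>u $ i\<bar>)" by (rule sum_distrib_left)
    also have "\<dots> < (\<Sum>i\<in>(UNIV :: 'd set). norm u)" using * by (intro sum_strict_mono) auto
    finally show False by simp
  qed
  then obtain i where i: "norm u \<le> ?d * \<bar>u $ i\<bar>" ..
  define \<beta> where "\<beta> = u $ i"
  have \<beta>: "\<bar>\<beta>\<bar> > 0" using i nu by (auto simp: \<beta>_def)
  \<comment> \<open>\<open>f\<close> overwrites coordinate \<open>i\<close> by 0, and
    \<open>Y\<close> is the box containing its image; the count is the size of \<open>Y\<close>
    times the largest fibre.\<close>
  define f where "f x = (\<chi> j. if j = i then 0 else x $ j)" for x :: "real ^ 'd"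
  define Y where "Y = {y :: real ^ 'd. \<forall>j. y $ j \<in> (if j = i then {0} else {y. y \<in> \<int> \<and> -R \<le> y \<and> y \<le> R})}"
  have finX: "finite ?X" by (rule finite_subset[OF _ finite_int_vecs_ball[of R]]) auto
  have finY: "finite Y" unfolding Y_def by (intro finite_vec_box) (auto simp: finite_Ints_interval)
  have fXY: "f ` ?X \<subseteq> Y"
    using int_vecs_ball_subset[of R] unfolding Y_def f_def by fastforce
  have cardY: "real (card Y) \<le> (3 * R) ^ (CARD('d) - 1)"
  proof -
    have "real (card Y) =
        (\<Prod>j\<in>(UNIV :: 'd set). real (card (if j = i then {0 :: real} else {y. y \<in> \<int> \<and> -R \<le> y \<and> y \<le> R})))"
      unfolding Y_def by (subst card_vec_box) simp
    also have "\<dots> \<le> (\<Prod>j\<in>(UNIV :: 'd set). if j = i then 1 else 3 * R)"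
      using card_Ints_interval_le[where a = "-R" and b = R] R by (intro prod_mono) auto
    also have "\<dots> = (\<Prod>j\<in>UNIV - {i}. 3 * R)"
      by (subst prod.remove[of _ i]) (auto intro!: prod.cong)
    also have "\<dots> = (3 * R) ^ (CARD('d) - 1)" by (simp add: card_Diff_singleton)
    finally show ?thesis .
  qed
  have fibre: "real (card {x \<in> ?X. f x = y}) \<le> 2 * ?d * norm u" for y
  proof -
    \<comment> \<open>On the fibre over \<open>y\<close> the inner product
      \<open>x \<bullet> u\<close> equals \<open>(x $ i - c) * \<beta>\<close>, so the slab
      condition reads \<open>\<bar>x $ i - c\<bar> \<le> h\<close>.\<close>
    define c where "c = - (y \<bullet> u) / \<beta>"
    define h where "h = (norm u)\<^sup>2 / (2 * \<bar>\<beta>\<bar>)"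
    have "inj_on (\<lambda>x. x $ i) {x \<in> ?X. f x = y}"
    proof (rule inj_onI)
      fix x x' assume "x \<in> {x \<in> ?X. f x = y}" "x' \<in> {x \<in> ?X. f x = y}" and e: "x $ i = x' $ i"
      then have f: "f x $ j = f x' $ j" for j by simp
      have "x $ j = x' $ j" for j
        using e f[of j] by (cases "j = i") (simp_all add: f_def)
      then show "x = x'" by (simp add: vec_eq_iff)
    qed
    moreover have "(\<lambda>x. x $ i) ` {x \<in> ?X. f x = y} \<subseteq> {t. t \<in> \<int> \<and> c - h \<le> t \<and> t \<le> c + h}"
    proof (rule image_subsetI)
      fix x assume "x \<in> {x \<in> ?X. f x = y}"
      then have x: "x \<in> int_vecs" "2 * \<bar>x \<bullet> u\<bar> \<le> (norm u)\<^sup>2" "f x = y" by auto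
      have "x \<bullet> u = x $ i * \<beta> + f x \<bullet> u"
        unfolding inner_vec_def f_def \<beta>_def
        by (subst (1 2) sum.remove[of _ i]) (auto intro!: sum.cong)
      then have "x \<bullet> u = (x $ i - c) * \<beta>" using \<beta> x(3) by (simp add: c_def field_simps)
      then have "2 * (\<bar>x $ i - c\<bar> * \<bar>\<beta>\<bar>) \<le> (norm u)\<^sup>2" using x(2) by (simp add: abs_mult)
      then have "\<bar>x $ i - c\<bar> \<le> h" using \<beta> by (simp add: h_def field_simps)
      then show "x $ i \<in> {t. t \<in> \<int> \<and> c - h \<le> t \<and> t \<le> c + h}"
        using x(1) by (auto simp: int_vecs_def abs_le_iff)
    qed
    ultimately have "card {x \<in> ?X. f x = y} \<le> card {t. t \<in> \<int> \<and> c - h \<le> t \<and> t \<le> c + h}"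
      by (rule card_inj_on_le[OF _ _ finite_Ints_interval])
    also have "real \<dots> \<le> (c + h) - (c - h) + 1"
      by (rule card_Ints_interval_le) (use \<beta> in \<open>simp add: h_def\<close>)
    also have "\<dots> = (norm u)\<^sup>2 / \<bar>\<beta>\<bar> + 1" by (simp add: h_def)
    also have "(norm u)\<^sup>2 / \<bar>\<beta>\<bar> \<le> ?d * norm u"
    proof -
      have "norm u * norm u \<le> norm u * (?d * \<bar>\<beta>\<bar>)" using i nu by (intro mult_left_mono) (auto simp: \<beta>_def)
      then show ?thesis using \<beta> by (simp add: divide_simps power2_eq_square mult_ac)
    qed
    \<comment> \<open>The extra 1 from counting integers in an interval is absorbed, which accounts
      for the factor 2 in the bound.\<close>
    also have "1 \<le> ?d * norm u" using mult_mono[OF d1 nu] by simp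
    finally show ?thesis by (simp add: mult_ac)
  qed
  have "?X = (\<Union>y\<in>Y. {x \<in> ?X. f x = y})" using fXY by blast
  then have "card ?X = card (\<Union>y\<in>Y. {x \<in> ?X. f x = y})" by (rule arg_cong)
  also have "\<dots> \<le> (\<Sum>y\<in>Y. card {x \<in> ?X. f x = y})" by (rule card_UN_le[OF finY])
  finally have "real (card ?X) \<le> (\<Sum>y\<in>Y. real (card {x \<in> ?X. f x = y}))"
    using of_nat_mono by fastforce
  also have "\<dots> \<le> (\<Sum>y\<in>Y. 2 * ?d * norm u)" by (intro sum_mono fibre)
  also have "\<dots> = real (card Y) * (2 * ?d * norm u)" by simp
  also have "\<dots> \<le> (3 * R) ^ (CARD('d) - 1) * (2 * ?d * norm u)"
    using cardY by (intro mult_right_mono) auto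
  finally show ?thesis by simp
qed

section \<open>Dyadic estimates for sums of inverse powers of the norm\<close>

lemma dyadic_shell:
  fixes x :: real
  assumes "1 \<le> x" "x < 2 ^ T"
  shows "\<exists>t<T. 2 ^ t \<le> x \<and> x < 2 ^ Suc t"
  using assms
proof (induction T)
  case (Suc T)
  then show ?case by (cases "x < 2 ^ T") (auto intro: less_SucI)
qed auto

text \<open>Each vector lies in a shell \<open>2 ^ t \<le> norm x < 2 ^ Suc t\<close> with
  \<open>t < T\<close>, where its norm may be replaced by the lower end
  \<open>2 ^ t\<close>.\<close>

lemma sum_power_le_dyadic:
  fixes X :: "'a::real_normed_vector set"
  assumes X: "finite X" "\<And>x. x \<in> X \<Longrightarrow> 1 \<le> norm x \<and> norm x < 2 ^ T" and R: "0 \<le> R"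
  shows "(\<Sum>x\<in>X. (R / norm x) ^ m)
           \<le> (\<Sum>t<T. real (card {x \<in> X. 2 ^ t \<le> norm x \<and> norm x < 2 ^ Suc t}) * (R / 2 ^ t) ^ m)"
proof -
  define Q where "Q t x \<longleftrightarrow> 2 ^ t \<le> norm x \<and> norm x < 2 ^ Suc t" for t and x :: 'a
  have "(\<Sum>x\<in>X. (R / norm x) ^ m) \<le> (\<Sum>x\<in>X. \<Sum>t<T. if Q t x then (R / 2 ^ t) ^ m else 0)"
  proof (rule sum_mono)
    fix x assume "x \<in> X"
    then obtain t where t: "t < T" "Q t x"
      using dyadic_shell[of "norm x" T] X(2) unfolding Q_def by blast
    have "(R / norm x) ^ m \<le> (R / 2 ^ t) ^ m"
      using t(2) R by (intro power_mono divide_left_mono) (auto simp: Q_def intro!: mult_pos_pos intro: less_le_trans[of 0 "2 ^ t"])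
    also have "\<dots> = (if Q t x then (R / 2 ^ t) ^ m else 0)" using t by simp
    also have "\<dots> \<le> (\<Sum>t<T. if Q t x then (R / 2 ^ t) ^ m else 0)"
      using t(1) R by (intro member_le_sum) auto
    finally show "(R / norm x) ^ m \<le> (\<Sum>t<T. if Q t x then (R / 2 ^ t) ^ m else 0)" .
  qed
  also have "\<dots> = (\<Sum>t<T. \<Sum>x\<in>X. if Q t x then (R / 2 ^ t) ^ m else 0)" by (rule sum.swap)
  also have "\<dots> = (\<Sum>t<T. real (card {x \<in> X. Q t x}) * (R / 2 ^ t) ^ m)"
    using X(1) by (intro sum.cong refl) (simp add: sum.If_cases Int_def)
  finally show ?thesis by (simp add: Q_def)
qed

definition nonzero_ball :: "real \<Rightarrow> (real ^ 'd) set" where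
  "nonzero_ball R = {x \<in> int_vecs. x \<noteq> 0 \<and> norm x \<le> R}"

lemma finite_nonzero_ball: "finite (nonzero_ball R)"
  by (rule finite_subset[OF _ finite_int_vecs_ball[of R]]) (auto simp: nonzero_ball_def)

lemma sum_nonzero_ball_le_dyadic:
  assumes "0 \<le> R" "R < 2 ^ T"
  shows "(\<Sum>x\<in>(nonzero_ball R :: (real ^ 'd) set). (R / norm x) ^ m)
           \<le> 5 ^ CARD('d) * (\<Sum>t<T. (2 ^ t) ^ CARD('d) * (R / 2 ^ t) ^ m)"
proof -
  let ?B = "nonzero_ball R :: (real ^ 'd) set"
  have "(\<Sum>x\<in>?B. (R / norm x) ^ m)
      \<le> (\<Sum>t<T. real (card {x \<in> ?B. 2 ^ t \<le> norm x \<and> norm x < 2 ^ Suc t}) * (R / 2 ^ t) ^ m)"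
    using assms norm_ge_1_int_vecs
    by (intro sum_power_le_dyadic finite_nonzero_ball) (auto simp: nonzero_ball_def)
  also have "\<dots> \<le> (\<Sum>t<T. (5 * 2 ^ t) ^ CARD('d) * (R / 2 ^ t) ^ m)"
  proof (intro sum_mono mult_right_mono)
    fix t
    have "real (card {x \<in> ?B. 2 ^ t \<le> norm x \<and> norm x < 2 ^ Suc t})
        \<le> real (card {x :: real ^ 'd \<in> int_vecs. norm x \<le> 2 ^ Suc t})"
      by (intro of_nat_mono card_mono finite_int_vecs_ball) (auto simp: nonzero_ball_def)
    also have "\<dots> \<le> (2 * 2 ^ Suc t + 1) ^ CARD('d)" by (intro card_int_vecs_ball) auto
    \<comment> \<open>Here \<open>2 * 2 ^ Suc t + 1\<close> is \<open>4 * 2 ^ t + 1\<close>, and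
      \<open>1 \<le> 2 ^ t\<close>.\<close>
    also have "\<dots> \<le> (5 * 2 ^ t) ^ CARD('d)" by (intro power_mono) auto
    finally show "real (card {x \<in> ?B. 2 ^ t \<le> norm x \<and> norm x < 2 ^ Suc t}) \<le> (5 * 2 ^ t) ^ CARD('d)" .
  qed (use assms in auto)
  also have "\<dots> = 5 ^ CARD('d) * (\<Sum>t<T. (2 ^ t) ^ CARD('d) * (R / 2 ^ t) ^ m)"
    by (simp add: sum_distrib_left power_mult_distrib mult_ac)
  finally show ?thesis .
qed

lemma ex_dyadic_bound:
  fixes R :: real
  assumes "1 \<le> R"
  obtains s where "2 ^ s \<le> R" "R < 2 ^ Suc s"
proof -
  obtain T where "R < 2 ^ T" using real_arch_pow[of 2 R] by auto
  then show ?thesis using dyadic_shell[of R T] assms that by blast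
qed

text \<open>For \<open>m < d\<close> the shell contributions grow geometrically with
  \<open>t\<close>, so the outermost shell, of radius about \<open>R\<close>, dominates.\<close>

lemma sum_nonzero_ball_small:
  assumes R: "1 \<le> R" and m: "m < CARD('d)"
  shows "(\<Sum>x\<in>(nonzero_ball R :: (real ^ 'd) set). (R / norm x) ^ m)
           \<le> 5 ^ CARD('d) * 2 ^ (CARD('d) - m) * R ^ CARD('d)"
proof -
  obtain s where s: "2 ^ s \<le> R" "R < 2 ^ Suc s" using ex_dyadic_bound[OF R] .
  define e where "e = CARD('d) - m"
  have de: "CARD('d) = e + m" and e: "e \<ge> 1" using m by (auto simp: e_def)
  \<comment> \<open>For ratio at least 2 a geometric sum is at most the first omitted term.\<close>
  have geo: "(\<Sum>t<T. (q :: real) ^ t) \<le> q ^ T" if "q \<ge> 2" for q T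
  proof (induction T)
    case (Suc T)
    have "q ^ T + q ^ T \<le> q * q ^ T" using mult_right_mono[of 2 q "q ^ T"] that by simp
    then show ?case using Suc by simp
  qed auto
  have "(\<Sum>t<Suc s. (2 ^ t) ^ CARD('d) * (R / 2 ^ t) ^ m) = (\<Sum>t<Suc s. R ^ m * (2 ^ e) ^ t)"
    by (intro sum.cong refl) (simp add: de power_add power_divide power_mult[symmetric] mult.commute)
  also have "\<dots> = R ^ m * (\<Sum>t<Suc s. (2 ^ e) ^ t)" by (rule sum_distrib_left[symmetric])
  also have "\<dots> \<le> R ^ m * (2 ^ e) ^ Suc s"
    using R e by (intro mult_left_mono geo) (auto intro: self_le_power)
  also have "(2 ^ e) ^ Suc s = (2 * 2 ^ s :: real) ^ e" by (simp add: power_mult[symmetric] power_mult_distrib mult.commute)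
  also have "\<dots> \<le> (2 * R) ^ e" using s by (intro power_mono) auto
  finally have "(\<Sum>t<Suc s. (2 ^ t) ^ CARD('d) * (R / 2 ^ t) ^ m) \<le> 2 ^ e * R ^ CARD('d)"
    using R by (simp add: de power_add power_mult_distrib mult_ac mult_left_mono)
  then have "5 ^ CARD('d) * (\<Sum>t<Suc s. (2 ^ t) ^ CARD('d) * (R / 2 ^ t) ^ m)
      \<le> 5 ^ CARD('d) * 2 ^ e * R ^ CARD('d)" by simp
  with sum_nonzero_ball_le_dyadic[of R "Suc s" m, where 'd = 'd] R s show ?thesis
    unfolding e_def by linarith
qed

lemma sum_half_power_le: "(\<Sum>t<T. (1 / 2 :: real) ^ t) \<le> 2"
proof -
  have "(\<Sum>t<T. (1 / 2 :: real) ^ t) = 2 * (1 - (1 / 2) ^ T)"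
    by (induction T) (auto simp: algebra_simps)
  also have "\<dots> \<le> 2" by simp
  finally show ?thesis .
qed

text \<open>For \<open>m > d\<close> the shell contributions decay at least by halves, so the
  innermost shell dominates.\<close>

lemma sum_nonzero_ball_large:
  assumes R: "1 \<le> R" and m: "CARD('d) < m"
  shows "(\<Sum>x\<in>(nonzero_ball R :: (real ^ 'd) set). (R / norm x) ^ m) \<le> 5 ^ CARD('d) * 2 * R ^ m"
proof -
  obtain s where s: "2 ^ s \<le> R" "R < 2 ^ Suc s" using ex_dyadic_bound[OF R] .
  define e where "e = m - CARD('d)"
  have de: "m = CARD('d) + e" and e: "e \<ge> 1" using m by (auto simp: e_def)
  have "(\<Sum>t<Suc s. (2 ^ t) ^ CARD('d) * (R / 2 ^ t) ^ m) \<le> (\<Sum>t<Suc s. R ^ m * (1 / 2) ^ t)"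
  proof (rule sum_mono)
    fix t
    have "(2 ^ t) ^ CARD('d) * (R / 2 ^ t) ^ m = R ^ m * ((1 / 2) ^ t) ^ e"
      by (simp add: de power_add power_divide)
    also have "((1 / 2 :: real) ^ t) ^ e \<le> ((1 / 2) ^ t) ^ 1"
      using e by (intro power_decreasing) (auto simp: power_le_one)
    finally show "(2 ^ t) ^ CARD('d) * (R / 2 ^ t) ^ m \<le> R ^ m * (1 / 2) ^ t"
      using R by (simp add: mult_left_mono)
  qed
  also have "\<dots> = R ^ m * (\<Sum>t<Suc s. (1 / 2) ^ t)" by (rule sum_distrib_left[symmetric])
  also have "\<dots> \<le> R ^ m * 2" using R by (intro mult_left_mono sum_half_power_le) auto
  finally have "5 ^ CARD('d) * (\<Sum>t<Suc s. (2 ^ t) ^ CARD('d) * (R / 2 ^ t) ^ m)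
      \<le> 5 ^ CARD('d) * 2 * R ^ m" by simp
  with sum_nonzero_ball_le_dyadic[of R "Suc s" m, where 'd = 'd] R s show ?thesis by linarith
qed

text \<open>For \<open>m = d\<close> every shell contributes the same amount \<open>R ^ d\<close>;
  the logarithm counts the shells.\<close>

lemma sum_nonzero_ball_critical:
  assumes R: "1 \<le> R"
  shows "(\<Sum>x\<in>(nonzero_ball R :: (real ^ 'd) set). (R / norm x) ^ CARD('d))
           \<le> 5 ^ CARD('d) * R ^ CARD('d) * (log 2 R + 1)"
proof -
  obtain s where s: "2 ^ s \<le> R" "R < 2 ^ Suc s" using ex_dyadic_bound[OF R] .
  have "real s \<le> log 2 R" using s(1) R by (simp add: le_log_iff powr_realpow)
  have "(\<Sum>t<Suc s. (2 ^ t) ^ CARD('d) * (R / 2 ^ t) ^ CARD('d)) = (\<Sum>t<Suc s. R ^ CARD('d))"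
    by (intro sum.cong refl) (simp add: power_divide)
  also have "\<dots> = real (Suc s) * R ^ CARD('d)" by simp
  also have "\<dots> \<le> (log 2 R + 1) * R ^ CARD('d)"
    using R \<open>real s \<le> log 2 R\<close> by (intro mult_right_mono) auto
  finally have "5 ^ CARD('d) * (\<Sum>t<Suc s. (2 ^ t) ^ CARD('d) * (R / 2 ^ t) ^ CARD('d))
      \<le> 5 ^ CARD('d) * R ^ CARD('d) * (log 2 R + 1)" by (simp add: mult_ac)
  with sum_nonzero_ball_le_dyadic[of R "Suc s" "CARD('d)", where 'd = 'd] R s show ?thesis by linarith
qed

text \<open>The candidates for \<open>b j\<close> with \<open>j > 0\<close> in a reduced basis with
  \<open>b 0 = u\<close>; the two inequalities come from the first two clauses of
  \<open>reduced_basis\<close>.\<close>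

definition reduced_ball :: "real \<Rightarrow> real ^ 'd \<Rightarrow> (real ^ 'd) set" where
  "reduced_ball R u = {x \<in> nonzero_ball R. norm u \<le> norm x \<and> 2 * \<bar>x \<bullet> u\<bar> \<le> (norm u)\<^sup>2}"

lemma finite_reduced_ball: "finite (reduced_ball R u)"
  by (rule finite_subset[OF _ finite_nonzero_ball[of R]]) (auto simp: reduced_ball_def)

text \<open>Without the inner product condition of \<^const>\<open>reduced_ball\<close> the sum would be of order
  \<open>R ^ d * log R\<close>.\<close>

lemma sum_reduced_ball_critical:
  fixes u :: "real ^ 'd" and R :: real
  assumes R: "1 \<le> R" and u: "u \<in> int_vecs" "u \<noteq> 0"
  shows "(\<Sum>x\<in>reduced_ball R u. (R / norm x) ^ CARD('d))
           \<le> 8 * real CARD('d) * 6 ^ (CARD('d) - 1) * R ^ CARD('d)"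
proof -
  let ?d = "CARD('d)"
  let ?K = "2 * real ?d * 6 ^ (?d - 1)"
  have nu: "1 \<le> norm u" using u by (rule norm_ge_1_int_vecs)
  obtain s where s: "2 ^ s \<le> R" "R < 2 ^ Suc s" using ex_dyadic_bound[OF R] .
  obtain a where a: "2 ^ a \<le> norm u" "norm u < 2 ^ Suc a" using ex_dyadic_bound[OF nu] by blast
  have "(\<Sum>x\<in>reduced_ball R u. (R / norm x) ^ ?d)
      \<le> (\<Sum>t<Suc s. real (card {x \<in> reduced_ball R u. 2 ^ t \<le> norm x \<and> norm x < 2 ^ Suc t}) * (R / 2 ^ t) ^ ?d)"
    using R s norm_ge_1_int_vecs
    by (intro sum_power_le_dyadic finite_reduced_ball) (auto simp: reduced_ball_def nonzero_ball_def)
  \<comment> \<open>Shells with \<open>t < a\<close> are empty, since candidates are at least as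
    long as \<open>u\<close>. In the others the slab count saves a factor
    \<open>norm u / 2 ^ t\<close> over the ball count, which makes the terms decay.\<close>
  also have "\<dots> \<le> (\<Sum>t<Suc s. if a \<le> t then ?K * R ^ ?d * (norm u / 2 ^ t) else 0)"
  proof (rule sum_mono)
    fix t
    let ?S = "{x \<in> reduced_ball R u. 2 ^ t \<le> norm x \<and> norm x < 2 ^ Suc t}"
    show "real (card ?S) * (R / 2 ^ t) ^ ?d \<le> (if a \<le> t then ?K * R ^ ?d * (norm u / 2 ^ t) else 0)"
    proof (cases "a \<le> t")
      case False
      then have "(2 :: real) ^ Suc t \<le> 2 ^ a" by (intro power_increasing) auto
      then have empty: "?S = {}" using a(1) by (auto simp: reduced_ball_def)
      show ?thesis unfolding empty using False by simp
    next
      case True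
      have "real (card ?S) \<le> real (card {x \<in> int_vecs. norm x \<le> 2 ^ Suc t \<and> 2 * \<bar>x \<bullet> u\<bar> \<le> (norm u)\<^sup>2})"
        by (intro of_nat_mono card_mono finite_subset[OF _ finite_int_vecs_ball[of "2 ^ Suc t"]])
          (auto simp: reduced_ball_def nonzero_ball_def)
      also have "\<dots> \<le> (3 * 2 ^ Suc t) ^ (?d - 1) * (2 * real ?d * norm u)"
        using one_le_power[of "2 :: real" "Suc t"] by (intro card_int_vecs_slab u) simp
      also have "(3 * 2 ^ Suc t :: real) = 6 * 2 ^ t" by simp
      also have "(6 * 2 ^ t) ^ (?d - 1) * (2 * real ?d * norm u) = ?K * norm u * (2 ^ t) ^ (?d - 1)"
        by (simp add: power_mult_distrib)
      finally have "real (card ?S) * (R / 2 ^ t) ^ ?d \<le> ?K * norm u * (2 ^ t) ^ (?d - 1) * (R / 2 ^ t) ^ ?d"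
        using R by (intro mult_right_mono) auto
      also have "\<dots> = ?K * R ^ ?d * (norm u / 2 ^ t)"
      proof -
        have "(R / 2 ^ t) ^ ?d = R ^ ?d / ((2 ^ t) ^ (?d - 1) * 2 ^ t)"
          by (simp add: power_divide flip: power_Suc2)
        then show ?thesis by simp
      qed
      finally show ?thesis using True by (simp only: if_True)
    qed
  qed
  also have "\<dots> = (\<Sum>t\<in>{..<Suc s} \<inter> {a..}. ?K * R ^ ?d * (norm u / 2 ^ t))"
    by (simp only: sum.inter_restrict[OF finite_lessThan] atLeast_iff)
  also have "\<dots> \<le> (\<Sum>t\<in>{a..<a + Suc s}. ?K * R ^ ?d * (norm u / 2 ^ t))"
    using R by (intro sum_mono2) auto
  also have "\<dots> = (\<Sum>t<Suc s. ?K * R ^ ?d * (norm u / 2 ^ (t + a)))"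
    using sum.shift_bounds_nat_ivl[of "\<lambda>t. ?K * R ^ ?d * (norm u / 2 ^ t)" 0 a "Suc s"]
    by (simp only: atLeast0LessThan add_0 add.commute[of "Suc s" a])
  \<comment> \<open>After the shift by \<open>a\<close>, the choice
    \<open>norm u < 2 ^ Suc a\<close> cancels the dependence on \<open>u\<close>.\<close>
  also have "\<dots> \<le> (\<Sum>t<Suc s. ?K * R ^ ?d * (2 * (1 / 2) ^ t))"
    using R a(2) by (intro sum_mono mult_left_mono) (auto simp: power_add field_simps)
  also have "\<dots> = ?K * R ^ ?d * 2 * (\<Sum>t<Suc s. (1 / 2) ^ t)"
    by (simp only: sum_distrib_left mult.assoc)
  also have "\<dots> \<le> ?K * R ^ ?d * 2 * 2" using R by (intro mult_left_mono sum_half_power_le) auto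
  finally show ?thesis by (simp add: mult_ac)
qed

section \<open>Tuples of integer vectors of given rank\<close>


lemma discrete_subgroup_int_vecs_Int:
  fixes W :: "(real ^ 'd) set"
  assumes "subspace W"
  shows "discrete_subgroup (int_vecs \<inter> W)"
  unfolding discrete_subgroup_def
proof (intro conjI ballI allI)
  show "0 \<in> int_vecs \<inter> W" using assms by (simp add: int_vecs_def subspace_0)
  fix x y assume "x \<in> int_vecs \<inter> W" "y \<in> int_vecs \<inter> W"
  then show "x - y \<in> int_vecs \<inter> W" using assms by (auto simp: int_vecs_def subspace_diff)
next
  fix R show "finite {x \<in> int_vecs \<inter> W. norm x \<le> R}"
    by (rule finite_subset[OF _ finite_int_vecs_ball[of R]]) auto
qed

text \<open>Tuples are extensional functions, so that each one is counted once and the set is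
  finite.\<close>

definition rank_tuples :: "nat \<Rightarrow> nat \<Rightarrow> real \<Rightarrow> (nat \<Rightarrow> real ^ 'd) set" where
  "rank_tuples m k N =
     {v \<in> PiE {..<m} (\<lambda>_. {x \<in> int_vecs. norm x \<le> N}). dim (v ` {..<m}) = k}"

lemma finite_rank_tuples: "finite (rank_tuples m k N)"
  by (rule finite_subset[of _ "PiE {..<m} (\<lambda>_. {x \<in> int_vecs. norm x \<le> N})"])
    (auto simp: rank_tuples_def intro!: finite_PiE finite_int_vecs_ball)

section \<open>Encoding a tuple by a reduced basis and a coefficient matrix\<close>

definition coeffs :: "real \<Rightarrow> real ^ 'd \<Rightarrow> int set" where
  "coeffs R x = {c. \<bar>of_int c\<bar> * norm x \<le> R}"

text \<open>With \<open>q\<close> the integer part of \<open>R / norm x\<close> there are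
  \<open>2 * q + 1\<close> coefficients, at most \<open>3 * q\<close> because \<open>x\<close> lies
  in the ball and so \<open>q \<ge> 1\<close>.\<close>

lemma coeffs_bound:
  assumes "x \<in> nonzero_ball R"
  shows finite_coeffs: "finite (coeffs R x)"
    and card_coeffs: "real (card (coeffs R x)) \<le> 3 * (R / norm x)"
proof -
  define q where "q = \<lfloor>R / norm x\<rfloor>"
  have x: "norm x > 0" "norm x \<le> R" using assms by (auto simp: nonzero_ball_def)
  have "coeffs R x = {-q..q}"
  proof (rule set_eqI)
    fix c
    have "c \<in> coeffs R x \<longleftrightarrow> \<bar>c\<bar> \<le> q"
      using x by (simp add: coeffs_def q_def le_floor_iff pos_le_divide_eq)
    also have "\<dots> \<longleftrightarrow> c \<in> {-q..q}" unfolding atLeastAtMost_iff by linarith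
    finally show "c \<in> coeffs R x \<longleftrightarrow> c \<in> {-q..q}" .
  qed
  moreover have "q \<ge> 1" using x by (simp add: q_def le_floor_iff)
  ultimately show "finite (coeffs R x)" "real (card (coeffs R x)) \<le> 3 * (R / norm x)"
    using of_int_floor_le[of "R / norm x"] by (auto simp: q_def[symmetric])
qed

text \<open>A tuple is recovered from a reduced basis of the integer lattice in its span and the
  coefficients of its entries. The outer sum is over the first basis vector; the power
  \<open>l\<close> comes from the remaining ones, chosen independently once \<open>u\<close> is
  fixed.\<close>

lemma card_rank_tuples_le_sum:
  "\<exists>C\<ge>1. \<forall>N. real (card (rank_tuples m (Suc l) N :: (nat \<Rightarrow> real ^ 'd) set))
      \<le> (\<Sum>u\<in>(nonzero_ball (C * N) :: (real ^ 'd) set). (3 * (C * N / norm u)) ^ m *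
            (\<Sum>x\<in>reduced_ball (C * N) u. (3 * (C * N / norm x)) ^ m) ^ l)"
proof -
  obtain C where C: "C \<ge> 1" and red: "\<And>L :: (real ^ 'd) set. discrete_subgroup L \<Longrightarrow> dim L = Suc l \<Longrightarrow>
      \<exists>b. reduced_basis C L (Suc l) b"
    using ex_reduced_basis[where k = "Suc l" and 'a = "real ^ 'd"] by blast
  have "real (card (rank_tuples m (Suc l) N :: (nat \<Rightarrow> real ^ 'd) set))
      \<le> (\<Sum>u\<in>(nonzero_ball (C * N) :: (real ^ 'd) set). (3 * (C * N / norm u)) ^ m *
            (\<Sum>x\<in>reduced_ball (C * N) u. (3 * (C * N / norm x)) ^ m) ^ l)" for N
  proof -
    define R where "R = C * N"
    define G where "G u = PiE {..<l} (\<lambda>_. reduced_ball R u)" for u :: "real ^ 'd"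
    define E where "E u g = PiE {..<m} (\<lambda>_. PiE {..<Suc l} (\<lambda>j. coeffs R (case_nat u g j)))"
      for u :: "real ^ 'd" and g
    \<comment> \<open>\<open>D\<close> is the set of codes (first vector, other vectors,
      coefficients) and \<open>F\<close> decodes. A tuple may have many codes; only an upper bound
      is wanted.\<close>
    define D where "D = (SIGMA u : (nonzero_ball R :: (real ^ 'd) set). SIGMA g : G u. E u g)"
    define F :: "_ \<Rightarrow> nat \<Rightarrow> real ^ 'd" where
      "F = (\<lambda>(u, g, c). \<lambda>i\<in>{..<m}. \<Sum>j<Suc l. of_int (c i j) *\<^sub>R case_nat u g j)"
    have finG: "finite (G u)" for u unfolding G_def by (intro finite_PiE finite_reduced_ball) auto
    have in_ball: "case_nat u g j \<in> nonzero_ball R"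
      if "u \<in> nonzero_ball R" "g \<in> G u" "j < Suc l" for u g j
      using that by (auto simp: G_def reduced_ball_def split: nat.splits)
    have finE: "finite (E u g)" if "u \<in> nonzero_ball R" "g \<in> G u" for u g
      unfolding E_def using in_ball[OF that] by (intro finite_PiE finite_coeffs) auto
    have finD: "finite D"
      unfolding D_def by (intro finite_SigmaI finite_nonzero_ball finG finE)
    have "rank_tuples m (Suc l) N \<subseteq> F ` D"
    proof
      fix v :: "nat \<Rightarrow> real ^ 'd" assume v: "v \<in> rank_tuples m (Suc l) N"
      then have vi: "v i \<in> int_vecs" "norm (v i) \<le> N" if "i < m" for i
        using that by (auto simp: rank_tuples_def)
      have dimv: "dim (v ` {..<m}) = Suc l" and vext: "v \<in> extensional {..<m}"
        using v by (auto simp: rank_tuples_def PiE_def)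
      \<comment> \<open>All integer vectors of the span: a discrete group that contains the tuple
        and has the same dimension.\<close>
      define L where "L = int_vecs \<inter> span (v ` {..<m})"
      have vL: "v ` {..<m} \<subseteq> L" using vi by (auto simp: L_def intro: span_base)
      have "span L = span (v ` {..<m})"
      proof (intro antisym span_minimal subspace_span)
        show "L \<subseteq> span (v ` {..<m})" by (auto simp: L_def)
        show "v ` {..<m} \<subseteq> span L" using vL span_superset by blast
      qed
      then have "dim L = Suc l" using dimv by (metis dim_span)
      moreover have L: "discrete_subgroup L"
        unfolding L_def by (rule discrete_subgroup_int_vecs_Int) (rule subspace_span)
      ultimately obtain b where b: "reduced_basis C L (Suc l) b" using red by blast
      have "\<exists>c :: nat \<Rightarrow> int. v i = (\<Sum>j<Suc l. of_int (c j) *\<^sub>R b j) \<and>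
        (\<forall>j<Suc l. \<bar>of_int (c j)\<bar> * norm (b j) \<le> C * norm (v i))" if "i < m" for i
        using b vL that unfolding reduced_basis_def by blast
      then obtain c :: "nat \<Rightarrow> nat \<Rightarrow> int" where
        c: "\<And>i. i < m \<Longrightarrow> v i = (\<Sum>j<Suc l. of_int (c i j) *\<^sub>R b j)"
           "\<And>i j. i < m \<Longrightarrow> j < Suc l \<Longrightarrow> \<bar>of_int (c i j)\<bar> * norm (b j) \<le> C * norm (v i)"
        by metis
      have cR: "\<bar>of_int (c i j)\<bar> * norm (b j) \<le> R" if "i < m" "j < Suc l" for i j
      proof -
        have "C * norm (v i) \<le> R"
          unfolding R_def using vi(2)[OF that(1)] C by (intro mult_left_mono) auto
        with c(2)[OF that] show ?thesis by linarith
      qed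
      have bL: "b j \<in> L" "b j \<noteq> 0" "norm (b 0) \<le> norm (b j)" if "j < Suc l" for j
        using b that unfolding reduced_basis_def by blast+
      \<comment> \<open>If no entry used \<open>b j\<close>, the tuple would lie in the span of the
        other \<open>l\<close> basis vectors, against its rank. A nonzero integer coefficient is at
        least 1 in absolute value, so the coefficient bound becomes a bound on
        \<open>norm (b j)\<close>.\<close>
      have bR: "norm (b j) \<le> R" if j: "j < Suc l" for j
      proof -
        have "\<exists>i<m. c i j \<noteq> 0"
        proof (rule ccontr)
          assume "\<not> ?thesis"
          then have z: "c i j = 0" if "i < m" for i using that by blast
          have "v ` {..<m} \<subseteq> span (b ` ({..<Suc l} - {j}))"
          proof (rule image_subsetI)
            fix i assume "i \<in> {..<m}"
            then have i: "i < m" by simp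
            have "v i = (\<Sum>j'\<in>{..<Suc l} - {j}. of_int (c i j') *\<^sub>R b j')"
              unfolding c(1)[OF i] using j z[OF i] by (subst sum.remove[of _ j]) auto
            also have "\<dots> \<in> span (b ` ({..<Suc l} - {j}))"
              by (intro span_sum span_scale span_base) auto
            finally show "v i \<in> span (b ` ({..<Suc l} - {j}))" .
          qed
          then have "dim (v ` {..<m}) \<le> card (b ` ({..<Suc l} - {j}))" by (intro dim_le_card) auto
          also have "\<dots> \<le> card ({..<Suc l} - {j})" by (intro card_image_le) auto
          also have "\<dots> = l" using j by (subst card_Diff_singleton) auto
          finally show False using dimv by simp
        qed
        then obtain i where i: "i < m" "c i j \<noteq> 0" by blast
        have "1 * norm (b j) \<le> \<bar>of_int (c i j)\<bar> * norm (b j)"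
          using i(2) by (intro mult_right_mono) auto
        then show ?thesis using cR[OF i(1) j] by simp
      qed
      have bball: "b j \<in> nonzero_ball R" if "j < Suc l" for j
        using bL[OF that] bR[OF that] by (auto simp: nonzero_ball_def L_def)
      have bred: "b (Suc j) \<in> reduced_ball R (b 0)" if "j < l" for j
        using b bball[of "Suc j"] bL(3)[of "Suc j"] that
        by (auto simp: reduced_ball_def reduced_basis_def)
      \<comment> \<open>The restrictions make \<open>g\<close> and \<open>c'\<close> extensional, as
        membership in \<open>G\<close> and \<open>E\<close> demands; \<open>g\<close> is shifted
        because \<open>b 0\<close> is stored separately.\<close>
      define g where "g = (\<lambda>j\<in>{..<l}. b (Suc j))"
      define c' where "c' = (\<lambda>i\<in>{..<m}. \<lambda>j\<in>{..<Suc l}. c i j)"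
      have gb: "case_nat (b 0) g j = b j" if "j < Suc l" for j
        using that by (auto simp: g_def split: nat.splits)
      have "g \<in> G (b 0)" using bred by (auto simp: g_def G_def)
      moreover have "c' \<in> E (b 0) g"
        unfolding E_def c'_def using cR gb by (auto simp: coeffs_def)
      ultimately have "(b 0, g, c') \<in> D" using bball[of 0] by (auto simp: D_def)
      moreover have "v = F (b 0, g, c')"
      proof
        fix i show "v i = F (b 0, g, c') i"
        proof (cases "i < m")
          case True
          have "(\<Sum>j<Suc l. of_int (c i j) *\<^sub>R b j)
              = (\<Sum>j<Suc l. of_int (c' i j) *\<^sub>R case_nat (b 0) g j)"
            using True gb by (intro sum.cong refl) (simp add: c'_def)
          then show ?thesis using c(1)[OF True] True by (simp add: F_def del: sum.lessThan_Suc)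
        next
          case False
          then show ?thesis using vext by (simp add: F_def extensional_def)
        qed
      qed
      ultimately show "v \<in> F ` D" by blast
    qed
    then have "card (rank_tuples m (Suc l) N :: (nat \<Rightarrow> real ^ 'd) set) \<le> card D"
      by (rule surj_card_le[OF finD])
    also have "card D = (\<Sum>u\<in>nonzero_ball R. \<Sum>g\<in>G u. card (E u g))"
    proof -
      have "card D = (\<Sum>u\<in>nonzero_ball R. card (SIGMA g : G u. E u g))"
        unfolding D_def
        by (intro card_SigmaI finite_nonzero_ball ballI finite_SigmaI finG finE)
      also have "\<dots> = (\<Sum>u\<in>nonzero_ball R. \<Sum>g\<in>G u. card (E u g))"
        by (intro sum.cong refl card_SigmaI finG ballI finE)
      finally show ?thesis .
    qed
    finally have "real (card (rank_tuples m (Suc l) N :: (nat \<Rightarrow> real ^ 'd) set))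
        \<le> (\<Sum>u\<in>(nonzero_ball R :: (real ^ 'd) set). \<Sum>g\<in>G u. real (card (E u g)))"
      using of_nat_mono by fastforce
    also have "\<dots> \<le> (\<Sum>u\<in>(nonzero_ball R :: (real ^ 'd) set). \<Sum>g\<in>G u.
        (3 * (R / norm u)) ^ m * (\<Prod>j<l. (3 * (R / norm (g j))) ^ m))"
    proof (intro sum_mono)
      fix u :: "real ^ 'd" and g assume u: "u \<in> nonzero_ball R" and g: "g \<in> G u"
      \<comment> \<open>The \<open>m\<close> rows of the coefficient matrix are independent and have
        the same range, whence the exponent \<open>m\<close>.\<close>
      have "real (card (E u g)) = (\<Prod>j<Suc l. real (card (coeffs R (case_nat u g j)))) ^ m"
        unfolding E_def by (simp add: card_PiE del: prod.lessThan_Suc)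
      also have "\<dots> \<le> (\<Prod>j<Suc l. 3 * (R / norm (case_nat u g j :: real ^ 'd))) ^ m"
        using in_ball[OF u g] by (intro power_mono prod_mono prod_nonneg conjI card_coeffs) auto
      also have "\<dots> = (3 * (R / norm u)) ^ m * (\<Prod>j<l. (3 * (R / norm (g j))) ^ m)"
        by (simp only: prod.lessThan_Suc_shift power_mult_distrib prod_power_distrib nat.case)
      finally show "real (card (E u g)) \<le> (3 * (R / norm u)) ^ m * (\<Prod>j<l. (3 * (R / norm (g j))) ^ m)" .
    qed
    also have "\<dots> = (\<Sum>u\<in>(nonzero_ball R :: (real ^ 'd) set). (3 * (R / norm u)) ^ m *
        (\<Sum>x\<in>reduced_ball R u. (3 * (R / norm x)) ^ m) ^ l)"
    proof (intro sum.cong refl)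
      fix u :: "real ^ 'd"
      \<comment> \<open>Distributivity: a sum over all choice functions of a product is the product
        of the sums.\<close>
      have "(\<Sum>g\<in>G u. \<Prod>j<l. (3 * (R / norm (g j))) ^ m)
          = (\<Prod>j<l. \<Sum>x\<in>reduced_ball R u. (3 * (R / norm x)) ^ m)"
        unfolding G_def by (rule prod_sum_PiE[symmetric]) (auto simp: finite_reduced_ball)
      then show "(\<Sum>g\<in>G u. (3 * (R / norm u)) ^ m * (\<Prod>j<l. (3 * (R / norm (g j))) ^ m))
          = (3 * (R / norm u)) ^ m * (\<Sum>x\<in>reduced_ball R u. (3 * (R / norm x)) ^ m) ^ l"
        by (simp flip: sum_distrib_left)
    qed
    finally show ?thesis unfolding R_def .
  qed
  with C show ?thesis by blast
qed

section \<open>Bounds that treat all relations between \<open>m\<close> and \<open>d\<close>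
  together\<close>

text \<open>The single logarithm of the critical case \<open>m = d\<close>. The summand 1 keeps the
  factor at least 1 down to \<open>R = 1\<close>.\<close>

definition log_factor :: "nat \<Rightarrow> nat \<Rightarrow> real \<Rightarrow> real" where
  "log_factor m d R = (if m = d then log 2 R + 1 else 1)"

text \<open>Both logarithms are nonnegative, so their sum plus 1 is at most the product of the two
  terms each increased by 1. This lets a rescaled radius be absorbed into the constant.\<close>

lemma log_factor_mult_le:
  assumes "1 \<le> C" "1 \<le> N"
  shows "log_factor m d (C * N) \<le> (log 2 C + 1) * log_factor m d N"
proof -
  have "log 2 C \<ge> 0" "log 2 N \<ge> 0" using assms by simp_all
  moreover have "log 2 (C * N) = log 2 C + log 2 N" using assms by (simp add: log_mult)
  ultimately show ?thesis by (simp add: log_factor_def algebra_simps)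
qed

lemma log_factor_ge_1:
  assumes "1 \<le> R"
  shows "1 \<le> log_factor m d R"
  using assms by (simp add: log_factor_def)

lemma sum_nonzero_ball_le:
  "\<exists>K\<ge>0. \<forall>R\<ge>1. (\<Sum>x\<in>(nonzero_ball R :: (real ^ 'd) set). (R / norm x) ^ m)
      \<le> K * (R ^ max m CARD('d) * log_factor m CARD('d) R)"
proof (cases m "CARD('d)" rule: linorder_cases)
  case less
  then show ?thesis
    using sum_nonzero_ball_small[OF _ less]
    by (intro exI[of _ "5 ^ CARD('d) * 2 ^ (CARD('d) - m)"]) (auto simp: log_factor_def max_def)
next
  case equal
  then show ?thesis
    using sum_nonzero_ball_critical[where 'd = 'd]
    by (intro exI[of _ "5 ^ CARD('d)"]) (auto simp: log_factor_def mult_ac)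
next
  case greater
  then show ?thesis
    using sum_nonzero_ball_large[OF _ greater]
    by (intro exI[of _ "5 ^ CARD('d) * 2"]) (auto simp: log_factor_def max_def)
qed

text \<open>Away from \<open>m = d\<close> the sum over the full ball already has no logarithm; at
  \<open>m = d\<close> the slab estimate removes it.\<close>

lemma sum_reduced_ball_le:
  "\<exists>K\<ge>0. \<forall>R\<ge>1. \<forall>u\<in>(nonzero_ball R :: (real ^ 'd) set).
      (\<Sum>x\<in>reduced_ball R u. (R / norm x) ^ m) \<le> K * R ^ max m CARD('d)"
proof (cases "m = CARD('d)")
  case True
  then show ?thesis
    using sum_reduced_ball_critical[where 'd = 'd]
    by (intro exI[of _ "8 * real CARD('d) * 6 ^ (CARD('d) - 1)"]) (auto simp: nonzero_ball_def)
next
  case False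
  then obtain K where K: "K \<ge> 0" "\<And>R. R \<ge> 1 \<Longrightarrow>
      (\<Sum>x\<in>(nonzero_ball R :: (real ^ 'd) set). (R / norm x) ^ m) \<le> K * R ^ max m CARD('d)"
    using sum_nonzero_ball_le[of m, where 'd = 'd] by (auto simp: log_factor_def)
  have "(\<Sum>x\<in>reduced_ball R u. (R / norm x) ^ m) \<le> K * R ^ max m CARD('d)"
    if "R \<ge> 1" for R and u :: "real ^ 'd"
  proof -
    have "(\<Sum>x\<in>reduced_ball R u. (R / norm x) ^ m) \<le> (\<Sum>x\<in>(nonzero_ball R :: (real ^ 'd) set). (R / norm x) ^ m)"
      using that by (intro sum_mono2 finite_nonzero_ball) (auto simp: reduced_ball_def)
    also have "\<dots> \<le> K * R ^ max m CARD('d)" using K(2)[OF that] .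
    finally show ?thesis .
  qed
  with K(1) show ?thesis by blast
qed

text \<open>Each of the \<open>k\<close> basis vectors contributes \<open>N ^ max m d\<close> up to
  a constant, and only the first one brings in \<open>log_factor\<close>. Rank 0 is separate because
  it has no first vector: there only the zero tuple exists.\<close>

lemma card_rank_tuples_le:
  "\<exists>K\<ge>0. \<forall>N\<ge>1. real (card (rank_tuples m k N :: (nat \<Rightarrow> real ^ 'd) set))
      \<le> K * (N ^ (max m CARD('d) * k) * log_factor m CARD('d) N)"
proof (cases k)
  case 0
  have "real (card (rank_tuples m k N :: (nat \<Rightarrow> real ^ 'd) set)) \<le> 1 * (N ^ (max m CARD('d) * k) * log_factor m CARD('d) N)"
    if "N \<ge> 1" for N
  proof -
    have "rank_tuples m k N \<subseteq> PiE {..<m} (\<lambda>_. {0 :: real ^ 'd})"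
    proof
      fix v :: "nat \<Rightarrow> real ^ 'd" assume "v \<in> rank_tuples m k N"
      then have "\<forall>i\<in>{..<m}. v i \<in> {0}" "v \<in> extensional {..<m}"
        by (auto simp: rank_tuples_def 0 dim_eq_0 PiE_def)
      then show "v \<in> PiE {..<m} (\<lambda>_. {0})" by (simp only: PiE_iff simp_thms)
    qed
    then have "card (rank_tuples m k N :: (nat \<Rightarrow> real ^ 'd) set) \<le> card (PiE {..<m} (\<lambda>_. {0 :: real ^ 'd}))"
      by (intro card_mono finite_PiE) auto
    also have "\<dots> = 1" by (simp add: card_PiE)
    finally have "real (card (rank_tuples m k N :: (nat \<Rightarrow> real ^ 'd) set)) \<le> 1" by simp
    also have "1 \<le> 1 * (N ^ (max m CARD('d) * k) * log_factor m CARD('d) N)"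
      using that by (simp add: 0 log_factor_def)
    finally show ?thesis .
  qed
  then show ?thesis by (intro exI[of _ 1]) auto
next
  case (Suc l)
  define e where "e = max m CARD('d)"
  obtain C where C: "C \<ge> 1" and count:
    "\<And>N. real (card (rank_tuples m (Suc l) N :: (nat \<Rightarrow> real ^ 'd) set))
      \<le> (\<Sum>u\<in>(nonzero_ball (C * N) :: (real ^ 'd) set). (3 * (C * N / norm u)) ^ m *
            (\<Sum>x\<in>reduced_ball (C * N) u. (3 * (C * N / norm x)) ^ m) ^ l)"
    using card_rank_tuples_le_sum[of m l, where 'd = 'd] by blast
  obtain A where A: "A \<ge> 0" "\<And>R. R \<ge> 1 \<Longrightarrow>
      (\<Sum>x\<in>(nonzero_ball R :: (real ^ 'd) set). (R / norm x) ^ m)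
      \<le> A * (R ^ e * log_factor m CARD('d) R)"
    using sum_nonzero_ball_le[of m, where 'd = 'd] unfolding e_def by blast
  obtain B where B: "B \<ge> 0" "\<And>R u. R \<ge> 1 \<Longrightarrow> u \<in> (nonzero_ball R :: (real ^ 'd) set) \<Longrightarrow>
      (\<Sum>x\<in>reduced_ball R u. (R / norm x) ^ m) \<le> B * R ^ e"
    using sum_reduced_ball_le[of m, where 'd = 'd] unfolding e_def by blast
  \<comment> \<open>\<open>A\<close> belongs to the first basis vector, \<open>B\<close> to each of
    the other \<open>l\<close>, every \<open>3 ^ m\<close> to the coefficient counts, and the powers
    of \<open>C\<close> and its logarithm to the passage from \<open>R = C * N\<close> to
    \<open>N\<close>.\<close>
  define K where "K = (3 ^ m * B) ^ l * (3 ^ m * A) * C ^ (e * k) * (log 2 C + 1)"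
  have "real (card (rank_tuples m k N :: (nat \<Rightarrow> real ^ 'd) set)) \<le> K * (N ^ (e * k) * log_factor m CARD('d) N)"
    if N: "N \<ge> 1" for N
  proof -
    define R where "R = C * N"
    have R: "R \<ge> 1" unfolding R_def using mult_mono[OF C N] C by simp
    have "real (card (rank_tuples m k N :: (nat \<Rightarrow> real ^ 'd) set))
        \<le> (\<Sum>u\<in>(nonzero_ball R :: (real ^ 'd) set). (3 * (R / norm u)) ^ m *
            (\<Sum>x\<in>reduced_ball R u. (3 * (R / norm x)) ^ m) ^ l)"
      using count[of N] by (simp add: Suc R_def)
    also have "\<dots> \<le> (\<Sum>u\<in>(nonzero_ball R :: (real ^ 'd) set). (3 * (R / norm u)) ^ m * (3 ^ m * (B * R ^ e)) ^ l)"
    proof (intro sum_mono mult_left_mono power_mono)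
      fix u :: "real ^ 'd" assume u: "u \<in> nonzero_ball R"
      have "(\<Sum>x\<in>reduced_ball R u. (3 * (R / norm x)) ^ m) = 3 ^ m * (\<Sum>x\<in>reduced_ball R u. (R / norm x) ^ m)"
        by (simp only: power_mult_distrib sum_distrib_left)
      then show "(\<Sum>x\<in>reduced_ball R u. (3 * (R / norm x)) ^ m) \<le> 3 ^ m * (B * R ^ e)"
        using B(2)[OF R u] by simp
    qed (use R in \<open>auto intro!: sum_nonneg\<close>)
    also have "\<dots> = (3 ^ m * (B * R ^ e)) ^ l * (3 ^ m * (\<Sum>u\<in>(nonzero_ball R :: (real ^ 'd) set). (R / norm u) ^ m))"
      by (simp only: power_mult_distrib[of 3] sum_distrib_left mult_ac)
    also have "\<dots> \<le> (3 ^ m * (B * R ^ e)) ^ l * (3 ^ m * (A * (R ^ e * log_factor m CARD('d) R)))"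
      using A(2)[OF R] B(1) R by (intro mult_left_mono) auto
    also have "\<dots> = (3 ^ m * B) ^ l * (3 ^ m * A) * (R ^ (e * k) * log_factor m CARD('d) R)"
      by (simp add: Suc power_mult_distrib power_add power_mult mult_ac)
    also have "\<dots> \<le> (3 ^ m * B) ^ l * (3 ^ m * A) * ((C * N) ^ (e * k) * ((log 2 C + 1) * log_factor m CARD('d) N))"
    proof -
      have "log_factor m CARD('d) R \<le> (log 2 C + 1) * log_factor m CARD('d) N"
        unfolding R_def by (rule log_factor_mult_le[OF C N])
      then show ?thesis using A(1) B(1) R unfolding R_def[symmetric] by (intro mult_left_mono) auto
    qed
    also have "\<dots> = K * (N ^ (e * k) * log_factor m CARD('d) N)"
      by (simp add: K_def power_mult_distrib mult_ac)
    finally show ?thesis .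
  qed
  moreover have "K \<ge> 0" using A(1) B(1) C by (simp add: K_def)
  ultimately show ?thesis unfolding e_def by blast
qed

section \<open>The deletion method\<close>


text \<open>The probability that a random subset, keeping points independently with probability
  \<open>p\<close>, contains \<open>e\<close>. In the expanded product over \<open>V\<close> the
  weight \<open>1 - p\<close> is replaced by 0 on \<open>e\<close>, which kills exactly the subsets
  missing a point of \<open>e\<close>.\<close>

lemma sum_weight_supersets:
  fixes p :: real
  assumes V: "finite V" "e \<subseteq> V"
  shows "(\<Sum>S\<in>{S \<in> Pow V. e \<subseteq> S}. p ^ card S * (1 - p) ^ card (V - S)) = p ^ card e"
proof -
  have "(\<Sum>S\<in>{S \<in> Pow V. e \<subseteq> S}. p ^ card S * (1 - p) ^ card (V - S))
      = (\<Sum>S\<in>Pow V. (\<Prod>x\<in>S. p) * (\<Prod>x\<in>V - S. if x \<in> e then 0 else 1 - p))"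
  proof (rule sum.mono_neutral_cong_left)
    show "\<forall>S\<in>Pow V - {S \<in> Pow V. e \<subseteq> S}. (\<Prod>x\<in>S. p) * (\<Prod>x\<in>V - S. if x \<in> e then 0 else 1 - p) = 0"
      using V by (auto simp: prod_zero_iff finite_subset)
    fix S assume "S \<in> {S \<in> Pow V. e \<subseteq> S}"
    then have "(\<Prod>x\<in>V - S. if x \<in> e then 0 else 1 - p) = (\<Prod>x\<in>V - S. 1 - p)"
      by (intro prod.cong) auto
    then show "p ^ card S * (1 - p) ^ card (V - S) =
        (\<Prod>x\<in>S. p) * (\<Prod>x\<in>V - S. if x \<in> e then 0 else 1 - p)" by simp
  qed (use V in auto)
  also have "\<dots> = (\<Prod>x\<in>V. p + (if x \<in> e then 0 else 1 - p))"
    by (rule prod_add[symmetric]) (rule V(1))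
  also have "\<dots> = (\<Prod>x\<in>e. p)"
    using V by (intro prod.mono_neutral_cong_right) auto
  finally show ?thesis by simp
qed

text \<open>Some subset \<open>S\<close> has at least the expected value of its size minus the
  number of members of \<open>H\<close> inside it. Removing one point from each of those destroys
  them all. Expectations are written as weighted sums over \<open>Pow V\<close>.\<close>

lemma deletion_method:
  fixes p :: real
  assumes V: "finite V" and H: "H \<subseteq> Pow V" "\<And>e. e \<in> H \<Longrightarrow> card e = r" and r: "0 < r"
    and p: "0 \<le> p" "p \<le> 1"
  shows "\<exists>A\<subseteq>V. (\<forall>e\<in>H. \<not> e \<subseteq> A) \<and> p * card V - p ^ r * card H \<le> card A"
proof -
  define w where "w S = p ^ card S * (1 - p) ^ card (V - S)" for S
  define X where "X S = {e \<in> H. e \<subseteq> S}" for S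
  have finH: "finite H" using H(1) V by (meson finite_Pow_iff finite_subset)
  have w0: "0 \<le> w S" for S using p by (simp add: w_def)
  \<comment> \<open>Linearity of expectation, stated for any family \<open>E\<close> so that it
    serves both the singletons, which count points, and \<open>H\<close>.\<close>
  have swap: "(\<Sum>S\<in>Pow V. w S * (\<Sum>e\<in>E. if e \<subseteq> S then 1 else 0)) = (\<Sum>e\<in>E. p ^ card e)"
    if E: "E \<subseteq> Pow V" for E
  proof -
    have "(\<Sum>S\<in>Pow V. w S * (\<Sum>e\<in>E. if e \<subseteq> S then 1 else 0))
        = (\<Sum>e\<in>E. \<Sum>S\<in>Pow V. w S * (if e \<subseteq> S then 1 else 0))"
      unfolding sum_distrib_left by (rule sum.swap)
    also have "\<dots> = (\<Sum>e\<in>E. p ^ card e)"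
    proof (rule sum.cong[OF refl])
      fix e assume "e \<in> E"
      have "(\<Sum>S\<in>Pow V. w S * (if e \<subseteq> S then 1 else 0)) = (\<Sum>S\<in>{S \<in> Pow V. e \<subseteq> S}. w S)"
        using V by (intro sum.mono_neutral_cong_right) auto
      then show "(\<Sum>S\<in>Pow V. w S * (if e \<subseteq> S then 1 else 0)) = p ^ card e"
        using sum_weight_supersets[OF V, of e p] \<open>e \<in> E\<close> E by (auto simp: w_def)
    qed
    finally show ?thesis .
  qed
  have total: "sum w (Pow V) = 1"
    using sum_weight_supersets[OF V, of "{}" p] by (simp add: w_def Pow_def)
  have vertices: "(\<Sum>S\<in>Pow V. w S * card S) = p * card V"
  proof -
    have "(\<Sum>S\<in>Pow V. w S * card S)
        = (\<Sum>S\<in>Pow V. w S * (\<Sum>e\<in>(\<lambda>x. {x}) ` V. if e \<subseteq> S then 1 else 0))"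
    proof (rule sum.cong[OF refl])
      fix S assume "S \<in> Pow V"
      then have "V \<inter> S = S" by auto
      have "(\<Sum>e\<in>(\<lambda>x. {x}) ` V. if e \<subseteq> S then 1 else 0) = (\<Sum>x\<in>V. if x \<in> S then 1 else (0 :: real))"
        by (subst sum.reindex) auto
      also have "\<dots> = card S" using V \<open>V \<inter> S = S\<close> by (simp flip: sum.inter_restrict)
      finally show "w S * card S = w S * (\<Sum>e\<in>(\<lambda>x. {x}) ` V. if e \<subseteq> S then 1 else 0)" by simp
    qed
    also have "\<dots> = (\<Sum>e\<in>(\<lambda>x. {x}) ` V. p ^ card e)" by (rule swap) auto
    also have "\<dots> = (\<Sum>x\<in>V. p)" by (subst sum.reindex) auto
    finally show ?thesis by simp
  qed
  have edges: "(\<Sum>S\<in>Pow V. w S * card (X S)) = p ^ r * card H"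
  proof -
    have "(\<Sum>S\<in>Pow V. w S * card (X S)) = (\<Sum>S\<in>Pow V. w S * (\<Sum>e\<in>H. if e \<subseteq> S then 1 else 0))"
      using finH by (intro sum.cong refl) (simp add: X_def sum.If_cases Int_def)
    also have "\<dots> = (\<Sum>e\<in>H. p ^ card e)" by (rule swap) (rule H(1))
    also have "\<dots> = (\<Sum>e\<in>H. p ^ r)" using H(2) by simp
    finally show ?thesis by simp
  qed
  have "\<exists>S\<in>Pow V. p * card V - p ^ r * card H \<le> real (card S) - card (X S)"
  proof (rule ccontr)
    let ?\<mu> = "p * card V - p ^ r * card H"
    assume "\<not> ?thesis"
    then have less: "real (card S) - card (X S) < ?\<mu>" if "S \<in> Pow V" for S
      using that by (auto simp: not_le)
    \<comment> \<open>Strict inequality of the weighted sums needs a set of positive weight; many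
      weights vanish when \<open>p\<close> is 0 or 1.\<close>
    obtain S where S: "S \<in> Pow V" "w S > 0"
    proof -
      have "\<not> (\<forall>S\<in>Pow V. w S \<le> 0)" using sum_nonpos[of "Pow V" w] total by auto
      then obtain S where "S \<in> Pow V" "\<not> w S \<le> 0" by blast
      then show ?thesis by (intro that[of S]) auto
    qed
    have "(\<Sum>S\<in>Pow V. w S * (real (card S) - card (X S))) < (\<Sum>S\<in>Pow V. w S * ?\<mu>)"
    proof (rule sum_strict_mono_ex1)
      show "\<forall>S\<in>Pow V. w S * (real (card S) - card (X S)) \<le> w S * ?\<mu>"
        by (intro ballI mult_left_mono less_imp_le[OF less] w0)
      show "\<exists>S\<in>Pow V. w S * (real (card S) - card (X S)) < w S * ?\<mu>"
        by (intro bexI[of _ S] mult_strict_left_mono less S)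
    qed (use V in auto)
    also have "(\<Sum>S\<in>Pow V. w S * ?\<mu>) = ?\<mu>" using total by (simp flip: sum_distrib_right)
    also have "(\<Sum>S\<in>Pow V. w S * (real (card S) - card (X S))) = ?\<mu>"
      by (simp add: right_diff_distrib sum_subtractf vertices edges)
    finally show False by simp
  qed
  then obtain S where S: "S \<subseteq> V" "p * card V - p ^ r * card H \<le> real (card S) - card (X S)" by auto
  have "\<exists>x. x \<in> e" if "e \<in> H" for e using H(2)[OF that] r by (metis card.empty ex_in_conv less_irrefl)
  then obtain pick where pick: "\<And>e. e \<in> H \<Longrightarrow> pick e \<in> e" by metis
  define A where "A = S - pick ` X S"
  have finS: "finite S" using S V finite_subset by blast
  have "\<not> e \<subseteq> A" if "e \<in> H" for e
    using pick[OF that] that by (auto simp: A_def X_def)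
  moreover have "real (card S) - card (X S) \<le> card A"
  proof -
    have "card (pick ` X S) \<le> card (X S)" using finH by (intro card_image_le) (auto simp: X_def)
    moreover have "card S \<le> card A + card (pick ` X S)"
      using diff_card_le_card_Diff[of "pick ` X S" S] finH by (simp add: A_def X_def)
    ultimately show ?thesis by linarith
  qed
  ultimately show ?thesis using S by (intro exI[of _ A]) (auto simp: A_def)
qed

section \<open>Points on a common flat\<close>


lemma finite_grid: "finite (grid n)"
  unfolding grid_def by (rule finite_vec_box) simp

lemma card_grid: "card (grid n :: (real ^ 'd) set) = n ^ CARD('d)"
proof -
  have "card (real ` {1..n}) = n" by (subst card_image) auto
  then show ?thesis unfolding grid_def by (subst card_vec_box) simp
qed

lemma grid_diff:
  fixes x y :: "real ^ 'd"
  assumes "x \<in> grid n" "y \<in> grid n"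
  shows "y - x \<in> int_vecs" "norm (y - x) \<le> real CARD('d) * real n"
proof -
  have comp: "x $ i \<in> \<int>" "0 \<le> x $ i" "x $ i \<le> n" "y $ i \<in> \<int>" "0 \<le> y $ i" "y $ i \<le> n" for i
  proof -
    have "x $ i \<in> real ` {1..n}" "y $ i \<in> real ` {1..n}" using assms by (auto simp: grid_def)
    then show "x $ i \<in> \<int>" "0 \<le> x $ i" "x $ i \<le> n" "y $ i \<in> \<int>" "0 \<le> y $ i" "y $ i \<le> n" by auto
  qed
  show "y - x \<in> int_vecs" using comp by (simp add: int_vecs_def)
  have "norm (y - x) \<le> (\<Sum>i\<in>UNIV. \<bar>(y - x) $ i\<bar>)" by (rule norm_le_l1_cart)
  also have "\<dots> \<le> (\<Sum>i\<in>(UNIV :: 'd set). real n)"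
  proof (rule sum_mono)
    fix i show "\<bar>(y - x) $ i\<bar> \<le> real n" using comp[of i] by (simp add: abs_le_iff)
  qed
  finally show "norm (y - x) \<le> real CARD('d) * real n" by simp
qed

text \<open>The forbidden configurations, playing the role of \<open>H\<close> in
  \<open>deletion_method\<close>.\<close>

definition flat_subsets :: "nat \<Rightarrow> nat \<Rightarrow> nat \<Rightarrow> (real ^ 'd) set set" where
  "flat_subsets n k r =
     {B. B \<subseteq> grid n \<and> card B = r \<and> (\<exists>F. affine F \<and> aff_dim F = int k \<and> B \<subseteq> F)}"

text \<open>Choose a base point of the configuration and record the \<open>m\<close> differences to
  it. They may span less than the direction space of the flat, hence the sum over all ranks
  \<open>j \<le> k\<close>.\<close>

lemma card_flat_subsets_le_sum:
  "card (flat_subsets n k (Suc m) :: (real ^ 'd) set set)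
     \<le> n ^ CARD('d) *
        (\<Sum>j\<le>k. card (rank_tuples m j (real CARD('d) * real n) :: (nat \<Rightarrow> real ^ 'd) set))"
proof -
  define N where "N = real CARD('d) * real n"
  define T where "T = (\<Union>j\<le>k. rank_tuples m j N :: (nat \<Rightarrow> real ^ 'd) set)"
  define \<Phi> where "\<Phi> = (\<lambda>(x :: real ^ 'd, v). insert x ((\<lambda>i. x + v i) ` {..<m}))"
  have finT: "finite T" unfolding T_def by (intro finite_UN_I finite_rank_tuples) auto
  have "flat_subsets n k (Suc m) \<subseteq> \<Phi> ` (grid n \<times> T)"
  proof
    fix B :: "(real ^ 'd) set" assume "B \<in> flat_subsets n k (Suc m)"
    then obtain F where B: "B \<subseteq> grid n" "card B = Suc m" and F: "affine F" "aff_dim F = int k" "B \<subseteq> F"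
      by (auto simp: flat_subsets_def)
    have "finite B" using B(2) card.infinite by fastforce
    then obtain f where "bij_betw f {0..<card B} B" using ex_bij_betw_nat_finite by blast
    then have f: "f ` {..<Suc m} = B" using B(2) by (simp add: bij_betw_def atLeast0LessThan)
    have fB: "f i \<in> B" if "i < Suc m" for i using f that by blast
    define v where "v = (\<lambda>i\<in>{..<m}. f (Suc i) - f 0)"
    have "v \<in> PiE {..<m} (\<lambda>_. {x \<in> int_vecs. norm x \<le> N})"
    proof (rule PiE_I)
      fix i assume "i \<in> {..<m}"
      then have i: "i < m" by simp
      have "f 0 \<in> grid n" "f (Suc i) \<in> grid n" using fB[of 0] fB[of "Suc i"] i B(1) by auto
      from grid_diff[OF this] show "v i \<in> {x \<in> int_vecs. norm x \<le> N}"
        using i by (simp add: v_def N_def)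
    qed (simp add: v_def)
    moreover have "dim (v ` {..<m}) \<le> k"
    proof -
      \<comment> \<open>Translating \<open>F\<close> by a point of it gives a set whose linear
        dimension is the affine dimension of \<open>F\<close>.\<close>
      have "v ` {..<m} \<subseteq> (\<lambda>z. z - f 0) ` F"
      proof (rule image_subsetI)
        fix i assume "i \<in> {..<m}"
        then show "v i \<in> (\<lambda>z. z - f 0) ` F" using fB[of "Suc i"] F(3) by (auto simp: v_def)
      qed
      then have "dim (v ` {..<m}) \<le> dim ((\<lambda>z. z - f 0) ` F)" by (rule dim_subset)
      moreover have "aff_dim F = int (dim ((\<lambda>z. z - f 0) ` F))"
        using fB[of 0] F(3) by (intro aff_dim_eq_dim_subtract hull_inc) auto
      ultimately show ?thesis using F(2) by simp
    qed
    ultimately have "v \<in> T" by (auto simp: T_def rank_tuples_def)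
    moreover have "B = \<Phi> (f 0, v)"
    proof -
      have "(\<lambda>i. f 0 + v i) ` {..<m} = (\<lambda>i. f (Suc i)) ` {..<m}"
        by (intro image_cong) (auto simp: v_def)
      moreover have "f ` {..<Suc m} = insert (f 0) ((\<lambda>i. f (Suc i)) ` {..<m})"
        by (simp add: lessThan_Suc_eq_insert_0 image_image)
      ultimately show ?thesis using f by (simp add: \<Phi>_def)
    qed
    ultimately show "B \<in> \<Phi> ` (grid n \<times> T)" using fB[of 0] B(1) by blast
  qed
  then have "card (flat_subsets n k (Suc m) :: (real ^ 'd) set set) \<le> card ((grid n :: (real ^ 'd) set) \<times> T)"
    by (rule surj_card_le[OF finite_cartesian_product[OF finite_grid finT]])
  also have "\<dots> = n ^ CARD('d) * card T" by (simp add: card_cartesian_product card_grid)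
  also have "\<dots> \<le> n ^ CARD('d) * (\<Sum>j\<le>k. card (rank_tuples m j N :: (nat \<Rightarrow> real ^ 'd) set))"
    unfolding T_def by (intro mult_le_mono2 card_UN_le) simp
  finally show ?thesis by (simp add: N_def)
qed

text \<open>The bound for rank \<open>k\<close> dominates those for lower ranks, since the base is
  at least 1. Differences of grid points have norm up to \<open>d * n\<close>, and the factor
  \<open>d\<close> goes into the constant.\<close>

lemma card_flat_subsets_le:
  "\<exists>K\<ge>1. \<forall>n\<ge>1. real (card (flat_subsets n k (Suc m) :: (real ^ 'd) set set))
      \<le> real n ^ CARD('d) * (K * (real n ^ (max m CARD('d) * k) * log_factor m CARD('d) n))"
proof -
  define e where "e = max m CARD('d)"
  define \<delta> where "\<delta> = real CARD('d)"
  have \<delta>: "\<delta> \<ge> 1" by (simp add: \<delta>_def Suc_leI)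
  have "\<exists>K\<ge>0. \<forall>N\<ge>1. real (card (rank_tuples m j N :: (nat \<Rightarrow> real ^ 'd) set))
      \<le> K * (N ^ (e * j) * log_factor m CARD('d) N)" for j
    unfolding e_def by (rule card_rank_tuples_le)
  then obtain K where K: "\<And>j. K j \<ge> 0" "\<And>j N. N \<ge> 1 \<Longrightarrow>
      real (card (rank_tuples m j N :: (nat \<Rightarrow> real ^ 'd) set)) \<le> K j * (N ^ (e * j) * log_factor m CARD('d) N)"
    by metis
  \<comment> \<open>The summand 1 guarantees \<open>K' \<ge> 1\<close>, which later keeps the
    sampling probability at most 1.\<close>
  define K' where "K' = 1 + (\<Sum>j\<le>k. K j) * (\<delta> ^ (e * k) * (log 2 \<delta> + 1))"
  have "K' \<ge> 1" using K(1) \<delta> by (simp add: K'_def sum_nonneg)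
  moreover have "real (card (flat_subsets n k (Suc m) :: (real ^ 'd) set set))
      \<le> real n ^ CARD('d) * (K' * (real n ^ (e * k) * log_factor m CARD('d) n))" if n: "n \<ge> 1" for n
  proof -
    let ?lf = "log_factor m CARD('d)"
    have n1: "real n \<ge> 1" using n by simp
    have \<delta>n: "\<delta> * real n \<ge> 1" using mult_mono[OF \<delta> n1] \<delta> by simp
    have lf: "?lf (\<delta> * real n) \<ge> 1" "?lf (real n) \<ge> 1" using log_factor_ge_1 \<delta>n n1 by auto
    have "real (card (rank_tuples m j (\<delta> * real n) :: (nat \<Rightarrow> real ^ 'd) set))
        \<le> K j * ((\<delta> ^ (e * k) * (log 2 \<delta> + 1)) * (real n ^ (e * k) * ?lf n))" if j: "j \<le> k" for j
    proof -
      have "real (card (rank_tuples m j (\<delta> * real n) :: (nat \<Rightarrow> real ^ 'd) set))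
          \<le> K j * ((\<delta> * real n) ^ (e * j) * ?lf (\<delta> * real n))" by (rule K(2)[OF \<delta>n])
      also have "\<dots> \<le> K j * ((\<delta> * real n) ^ (e * k) * ((log 2 \<delta> + 1) * ?lf n))"
        using K(1) \<delta>n lf j log_factor_mult_le[OF \<delta> n1]
        by (intro mult_left_mono mult_mono power_increasing) auto
      also have "\<dots> = K j * ((\<delta> ^ (e * k) * (log 2 \<delta> + 1)) * (real n ^ (e * k) * ?lf n))"
        by (simp add: power_mult_distrib mult_ac)
      finally show ?thesis .
    qed
    then have "(\<Sum>j\<le>k. real (card (rank_tuples m j (\<delta> * real n) :: (nat \<Rightarrow> real ^ 'd) set)))
        \<le> (\<Sum>j\<le>k. K j * ((\<delta> ^ (e * k) * (log 2 \<delta> + 1)) * (real n ^ (e * k) * ?lf n)))"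
      by (intro sum_mono) auto
    also have "\<dots> = (K' - 1) * (real n ^ (e * k) * ?lf n)"
      by (simp add: K'_def mult.assoc flip: sum_distrib_right)
    also have "\<dots> \<le> K' * (real n ^ (e * k) * ?lf n)"
      using lf by (intro mult_right_mono) auto
    finally have *: "(\<Sum>j\<le>k. real (card (rank_tuples m j (\<delta> * real n) :: (nat \<Rightarrow> real ^ 'd) set)))
        \<le> K' * (real n ^ (e * k) * ?lf n)" .
    have "real (card (flat_subsets n k (Suc m) :: (real ^ 'd) set set))
        \<le> real (n ^ CARD('d) * (\<Sum>j\<le>k. card (rank_tuples m j (\<delta> * real n) :: (nat \<Rightarrow> real ^ 'd) set)))"
      unfolding \<delta>_def by (intro of_nat_mono card_flat_subsets_le_sum)
    also have "\<dots> = real n ^ CARD('d) * (\<Sum>j\<le>k. real (card (rank_tuples m j (\<delta> * real n) :: (nat \<Rightarrow> real ^ 'd) set)))"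
      by simp
    also have "\<dots> \<le> real n ^ CARD('d) * (K' * (real n ^ (e * k) * ?lf n))"
      by (intro mult_left_mono *) simp
    finally show ?thesis .
  qed
  ultimately show ?thesis unfolding e_def by blast
qed

section \<open>The lower bound for \<open>f_aff\<close> by random sampling of the grid\<close>

lemma card_le_f_aff:
  fixes A :: "(real ^ 'd) set"
  assumes "A \<subseteq> grid n" "no_r_on_k_flat k r A"
  shows "card A \<le> f_aff TYPE('d) n k r"
proof -
  have "{card A | A :: (real ^ 'd) set. A \<subseteq> grid n \<and> no_r_on_k_flat k r A} \<subseteq> card ` Pow (grid n :: (real ^ 'd) set)"
    by auto
  then have "finite {card A | A :: (real ^ 'd) set. A \<subseteq> grid n \<and> no_r_on_k_flat k r A}"
    by (rule finite_subset) (simp add: finite_grid)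
  then show ?thesis unfolding f_aff_def using assms by (intro Max_ge) auto
qed

lemma f_aff_ge:
  assumes m: "0 < m"
  shows "\<exists>c>0. \<forall>n\<ge>1. c * (real n ^ CARD('d) /
      (real n ^ (max m CARD('d) * k) * log_factor m CARD('d) n) powr (1 / m))
      \<le> f_aff TYPE('d::finite) n k (Suc m)"
proof -
  define Q where "Q n = real n ^ (max m CARD('d) * k) * log_factor m CARD('d) n" for n
  obtain K where K: "K \<ge> 1" "\<And>n. n \<ge> 1 \<Longrightarrow>
      real (card (flat_subsets n k (Suc m) :: (real ^ 'd) set set)) \<le> real n ^ CARD('d) * (K * Q n)"
    using card_flat_subsets_le[of k m, where 'd = 'd] unfolding Q_def by blast
  \<comment> \<open>Chosen so that the claimed bound is exactly \<open>p * n ^ d / 2\<close> for the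
    \<open>p\<close> below.\<close>
  define c where "c = 1 / (2 * (2 * K) powr (1 / m))"
  have "c * (real n ^ CARD('d) / Q n powr (1 / m)) \<le> f_aff TYPE('d) n k (Suc m)" if n: "n \<ge> 1" for n
  proof -
    let ?H = "flat_subsets n k (Suc m) :: (real ^ 'd) set set"
    have "1 \<le> real n ^ (max m CARD('d) * k)" "1 \<le> log_factor m CARD('d) n"
      using n by (auto intro: log_factor_ge_1)
    then have Q: "Q n \<ge> 1" unfolding Q_def using mult_mono[of 1 _ 1] by fastforce
    have KQ: "2 * K * Q n \<ge> 1" using mult_mono[of 1 "2 * K" 1 "Q n"] K(1) Q by simp
    \<comment> \<open>The balance \<open>p ^ m * K * Q n = 1 / 2\<close> makes the expected number
      of forbidden configurations at most half the expected number of points.\<close>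
    define p where "p = 1 / (2 * K * Q n) powr (1 / m)"
    have pos: "(2 * K * Q n) powr (1 / m) \<ge> 1" using KQ by (intro ge_one_powr_ge_zero) auto
    have p: "0 \<le> p" "p \<le> 1" using pos frac_le[of 1 1 1 "(2 * K * Q n) powr (1 / m)"] by (simp_all add: p_def)
    have pm: "p ^ m = 1 / (2 * K * Q n)"
    proof -
      have "((2 * K * Q n) powr (1 / m)) ^ m = 2 * K * Q n"
        using KQ m by (subst powr_power) auto
      then show ?thesis by (simp add: p_def power_divide)
    qed
    have "\<exists>A\<subseteq>(grid n :: (real ^ 'd) set). (\<forall>e\<in>?H. \<not> e \<subseteq> A) \<and>
        p * card (grid n :: (real ^ 'd) set) - p ^ Suc m * card ?H \<le> card A"
      using p by (intro deletion_method finite_grid) (auto simp: flat_subsets_def)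
    then obtain A :: "(real ^ 'd) set" where A: "A \<subseteq> grid n" "\<And>e. e \<in> ?H \<Longrightarrow> \<not> e \<subseteq> A"
      "p * real n ^ CARD('d) - p ^ Suc m * card ?H \<le> card A"
      by (auto simp: card_grid)
    have "no_r_on_k_flat k (Suc m) A"
      using A(1,2) unfolding no_r_on_k_flat_def flat_subsets_def by blast
    then have "card A \<le> f_aff TYPE('d) n k (Suc m)" using card_le_f_aff A(1) by blast
    moreover have "c * (real n ^ CARD('d) / Q n powr (1 / m)) \<le> p * real n ^ CARD('d) - p ^ Suc m * card ?H"
    proof -
      have "p ^ Suc m * card ?H \<le> p ^ Suc m * (real n ^ CARD('d) * (K * Q n))"
        using K(2)[OF n] p by (intro mult_left_mono) auto
      also have "\<dots> = p * real n ^ CARD('d) * (p ^ m * (K * Q n))" by simp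
      also have "p ^ m * (K * Q n) = 1 / 2" unfolding pm using K(1) Q by simp
      finally have "p * real n ^ CARD('d) / 2 \<le> p * real n ^ CARD('d) - p ^ Suc m * card ?H" by simp
      moreover have "c * (real n ^ CARD('d) / Q n powr (1 / m)) = p * real n ^ CARD('d) / 2"
        using K(1) Q by (simp add: c_def p_def powr_mult)
      ultimately show ?thesis by (simp only:)
    qed
    ultimately show ?thesis using A(3) by linarith
  qed
  moreover have "c > 0" using K(1) by (simp add: c_def)
  ultimately show ?thesis unfolding Q_def by blast
qed

section \<open>Comparison with the explicit growth functions\<close>

text \<open>With \<open>m = r - 1\<close> the three cases of \<open>f_dkr\<close> are
  \<open>m < d\<close>, \<open>m = d\<close> and \<open>m > d\<close>, and the exponent
  \<open>max m d * k / m\<close> is \<open>d * k / m\<close> in the first case and \<open>k\<close>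
  in the other two.\<close>

lemma f_dkr_le:
  assumes m: "0 < m" and n: "3 \<le> n"
  shows "f_dkr d k (Suc m) n
    \<le> 3 powr (1 / m) * (real n ^ d / (real n ^ (max m d * k) * log_factor m d n) powr (1 / m))"
proof -
  \<comment> \<open>\<open>g\<close> is the natural logarithm of \<open>f_dkr\<close> in the
    critical case. Since \<open>n \<ge> 3\<close> exceeds \<open>exp 1\<close>, it is at least 1,
    and \<open>log 2 n + 1 \<le> 3 * ln n\<close> explains the constant 3.\<close>
  define g where "g = (if m = d then ln (real n) else 1)"
  have n0: "real n > 0" using n by simp
  have "exp 1 \<le> real n" using exp_le n by linarith
  then have ln1: "1 \<le> ln (real n)" using n0 by (simp add: ln_ge_iff)
  have g1: "1 \<le> g" using ln1 by (simp add: g_def)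
  have "log 2 (real n) \<le> 2 * ln (real n)"
  proof -
    have "ln (real n) * 1 \<le> ln (real n) * (2 * ln 2)"
      using ln2_ge_two_thirds ln1 by (intro mult_left_mono) auto
    then show ?thesis by (simp add: log_def divide_le_eq mult_ac)
  qed
  then have lf: "log_factor m d n \<le> 3 * g" using ln1 by (simp add: log_factor_def g_def)
  have lf1: "1 \<le> log_factor m d n" using n by (intro log_factor_ge_1) simp
  define P where "P = real n ^ (max m d * k)"
  have P: "P > 0" using n0 by (simp add: P_def)
  have P_powr: "P powr (1 / m) = real n powr (real (max m d) * k / m)"
    unfolding P_def using n0 by (simp add: powr_powr flip: powr_realpow)
  have "f_dkr d k (Suc m) n = real n ^ d / (P powr (1 / m) * g powr (1 / m))"
  proof (cases m d rule: linorder_cases)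
    case less
    then have "f_dkr d k (Suc m) n = real n powr (real d - real d * k / m)"
      by (simp add: f_dkr_def right_diff_distrib)
    also have "\<dots> = real n ^ d / P powr (1 / m)"
      using less n0 by (simp add: P_powr powr_diff powr_realpow)
    finally show ?thesis using less by (simp add: g_def)
  next
    case equal
    then have "P powr (1 / d) = real n ^ k" using P_powr m n0 by (simp add: powr_realpow)
    then show ?thesis using equal m n0
      by (simp add: f_dkr_def powr_diff powr_realpow g_def)
  next
    case greater
    then show ?thesis using m n0
      by (simp add: f_dkr_def P_powr powr_diff powr_realpow g_def)
  qed
  also have "\<dots> \<le> 3 powr (1 / m) * (real n ^ d / (P * log_factor m d n) powr (1 / m))"
  proof -
    have "log_factor m d n powr (1 / m) \<le> (3 * g) powr (1 / m)"
      using lf lf1 by (intro powr_mono2) auto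
    also have "\<dots> = 3 powr (1 / m) * g powr (1 / m)" using g1 by (simp add: powr_mult)
    finally have "log_factor m d n powr (1 / m) \<le> 3 powr (1 / m) * g powr (1 / m)" .
    then have "1 / g powr (1 / m) \<le> 3 powr (1 / m) / log_factor m d n powr (1 / m)"
      using g1 lf1 by (simp add: divide_simps)
    then have "real n ^ d / P powr (1 / m) * (1 / g powr (1 / m))
        \<le> real n ^ d / P powr (1 / m) * (3 powr (1 / m) / log_factor m d n powr (1 / m))"
      by (intro mult_left_mono) auto
    then show ?thesis using P lf1 by (simp add: powr_mult mult_ac)
  qed
  finally show ?thesis unfolding P_def .
qed

lemma f_dkr_nonneg: "3 \<le> n \<Longrightarrow> 0 \<le> f_dkr d k r n"
  by (simp add: f_dkr_def)

lemma f_aff_bigomega: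
  assumes "2 \<le> r"
  shows "(\<lambda>n. real (f_aff TYPE('d::finite) n k r)) \<in> \<Omega>(\<lambda>n. f_dkr CARD('d) k r n)"
proof -
  obtain m where r: "r = Suc m" "0 < m" using assms by (cases r) auto
  obtain c where c: "c > 0" "\<And>n. n \<ge> 1 \<Longrightarrow> c * (real n ^ CARD('d) /
      (real n ^ (max m CARD('d) * k) * log_factor m CARD('d) n) powr (1 / m))
      \<le> f_aff TYPE('d) n k (Suc m)"
    using f_aff_ge[OF r(2), of k, where 'd = 'd] by blast
  define c' where "c' = c / 3 powr (1 / m)"
  have "c' > 0" using c(1) by (simp add: c'_def)
  moreover have "c' * norm (f_dkr CARD('d) k r n) \<le> norm (real (f_aff TYPE('d) n k r))" if "n \<ge> 3" for n
  proof -
    have "c' * f_dkr CARD('d) k r n \<le> c' * (3 powr (1 / m) * (real n ^ CARD('d) /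
      (real n ^ (max m CARD('d) * k) * log_factor m CARD('d) n) powr (1 / m)))"
      unfolding r(1) using f_dkr_le[OF r(2) that] \<open>c' > 0\<close> by (intro mult_left_mono) auto
    also have "\<dots> = c * (real n ^ CARD('d) /
      (real n ^ (max m CARD('d) * k) * log_factor m CARD('d) n) powr (1 / m))"
      by (simp add: c'_def)
    also have "\<dots> \<le> f_aff TYPE('d) n k r" unfolding r(1) using that by (intro c(2)) simp
    finally show ?thesis using f_dkr_nonneg[OF that] by simp
  qed
  ultimately show ?thesis
    by (intro landau_omega.bigI[of c'] eventually_sequentiallyI[of 3]) auto
qed

text \<open>For \<open>r = k + 2\<close> and \<open>k < d\<close> the last case of
  \<open>f_dkr\<close> cannot occur, and \<open>1 - k / (k + 1) = 1 / (k + 1)\<close>.\<close>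

lemma f_dkr_eq_f_dk:
  assumes "k < d"
  shows "f_dkr d k (k + 2) = f_dk d k"
proof (cases "k + 1 = d")
  case True
  then show ?thesis by (auto simp: f_dkr_def f_dk_def fun_eq_iff)
next
  case False
  have "real d * (1 - real k / (real (k + 2) - 1)) = real d / (real k + 1)"
    by (simp add: field_simps)
  then show ?thesis using False assms by (simp add: f_dkr_def f_dk_def fun_eq_iff)
qed

theorem theorem1p1:
  fixes k r :: nat
  assumes "0 < k" and "k < CARD('d::finite)" and "k + 2 \<le> r"
  shows "(\<lambda>n. real (f_aff TYPE('d) n k r)) \<in> \<Omega>(\<lambda>n. f_dkr CARD('d) k r n) \<and>
         (\<lambda>n. real (f_aff TYPE('d) n k (k + 2))) \<in> \<Omega>(\<lambda>n. f_dk CARD('d) k n)"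
proof
  show "(\<lambda>n. real (f_aff TYPE('d) n k r)) \<in> \<Omega>(\<lambda>n. f_dkr CARD('d) k r n)"
    using assms(3) by (intro f_aff_bigomega) simp
  have "(\<lambda>n. real (f_aff TYPE('d) n k (k + 2))) \<in> \<Omega>(\<lambda>n. f_dkr CARD('d) k (k + 2) n)"
    by (rule f_aff_bigomega) simp
  then show "(\<lambda>n. real (f_aff TYPE('d) n k (k + 2))) \<in> \<Omega>(\<lambda>n. f_dk CARD('d) k n)"
    unfolding f_dkr_eq_f_dk[OF assms(2)] .
qed

end
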